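(* Let $N\ge 1$ be an integer, let $w_0,\dots,w_N\in\mathbb{C}$ be nonzero and pairwise distinct, and let $\tau_0,\dots,\tau_N\in\mathbb{C}$. Let $-1\le N_1\le N_2\le N$ be integers such that $\pm\tau_j\notin\mathbb{N}_0$ if $0\le j\le N_1$, $\tau_j=k_j\in\mathbb{N}$ if $N_1+1\le j\le N_2$, and $-\tau_j\in\mathbb{N}$ if $N_2+1\le j\le N$ (empty ranges allowed). Let $K_m$ ($0\le m\le N_1$) be arbitrary fixed nonnegative integers. Then, as $n\to\infty$, $$G_n^{(N)}(\tau_j,w_j)=\sum_{m=0}^{N_1}\sum_{r=0}^{K_m}A_m(w_j)\,c_r^{(m)}\,\frac{(\tau_m-r)_n}{n!}\Big(w_m^n+O\Big(\frac{w_m^n}{n}\Big)\Big)+\sum_{m=N_1+1}^{N_2}\sum_{r=0}^{k_m-1}A_m(w_j)\,w_m^n\,\frac{(n+r)!\,c^{(m)}_{k_m-r-1}}{r!\,n!},$$ where each $O(w_m^n/n)$ stands for a quantity $e_{m,r}(n)$ with $|e_{m,r}(n)|\le C\,|w_m|^n/n$ for all sufficiently large $n$, $C$ independent of $n$.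
   Context: $\mathbb{N}=\{1,2,\dots\}$, $\mathbb{N}_0=\mathbb{N}\cup\{0\}$, and $(a)_n=a(a+1)\cdots(a+n-1)$, $(a)_0=1$. The numbers $G_n^{(N)}(\tau_j,w_j)$ are the Maclaurin coefficients in $$\prod_{j=0}^{N}(1-w_jz)^{-\tau_j}=\sum_{n=0}^\infty G_n^{(N)}(\tau_j,w_j)\,z^n\qquad(|z|\text{ small}),$$ each power being the branch equal to $1$ at $z=0$. For $0\le m\le N$, $$A_m(w_j)=\prod_{\substack{j=0\\ j\ne m}}^{N}\Big(1-\frac{w_j}{w_m}\Big)^{-\tau_j}$$ (principal powers), and $c_r^{(m)}$ are the Maclaurin coefficients of $$\phi_m(u)=\prod_{\substack{k=0\\ k\ne m}}^{N}\Big(1-\frac{w_k}{w_k-w_m}\,u\Big)^{-\tau_k}=\sum_{r=0}^\infty c_r^{(m)}u^r\qquad(|u|\text{ small}),$$ with each factor equal to $1$ at $u=0$. *)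

theory Defs
  imports "HOL-Complex_Analysis.Complex_Analysis" "HOL-Library.Landau_Symbols"
begin

text \<open>
  Powers are principal (\<^const>\<open>powr\<close>). Near the origin the bases below are close to \<open>1\<close>, so
  there the principal power is exactly the branch that equals \<open>1\<close> at the origin.
\<close>

definition gen_fun :: "nat \<Rightarrow> (nat \<Rightarrow> complex) \<Rightarrow> (nat \<Rightarrow> complex) \<Rightarrow> complex \<Rightarrow> complex" where
  "gen_fun N \<tau> w z = (\<Prod>j\<in>{0..N}. (1 - w j * z) powr (- \<tau> j))"

definition G_coeff :: "nat \<Rightarrow> (nat \<Rightarrow> complex) \<Rightarrow> (nat \<Rightarrow> complex) \<Rightarrow> nat \<Rightarrow> complex" where
  "G_coeff N \<tau> w n = fps_nth (fps_expansion (gen_fun N \<tau> w) 0) n"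

definition A_const :: "nat \<Rightarrow> (nat \<Rightarrow> complex) \<Rightarrow> (nat \<Rightarrow> complex) \<Rightarrow> nat \<Rightarrow> complex" where
  "A_const N \<tau> w m = (\<Prod>j\<in>{0..N} - {m}. (1 - w j / w m) powr (- \<tau> j))"

definition phi :: "nat \<Rightarrow> (nat \<Rightarrow> complex) \<Rightarrow> (nat \<Rightarrow> complex) \<Rightarrow> nat \<Rightarrow> complex \<Rightarrow> complex" where
  "phi N \<tau> w m u = (\<Prod>k\<in>{0..N} - {m}. (1 - w k / (w k - w m) * u) powr (- \<tau> k))"

definition c_coeff :: "nat \<Rightarrow> (nat \<Rightarrow> complex) \<Rightarrow> (nat \<Rightarrow> complex) \<Rightarrow> nat \<Rightarrow> nat \<Rightarrow> complex" where
  "c_coeff N \<tau> w m r = fps_nth (fps_expansion (phi N \<tau> w m) 0) r"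

lemma gen_fun_has_fps_expansion: "gen_fun N \<tau> w has_fps_expansion Abs_fps (G_coeff N \<tau> w)"
proof -
  have "gen_fun N \<tau> w analytic_on {0}"
    unfolding gen_fun_def by (intro analytic_intros) auto
  moreover have "Abs_fps (G_coeff N \<tau> w) = fps_expansion (gen_fun N \<tau> w) 0"
    by (simp add: fps_eq_iff G_coeff_def)
  ultimately show ?thesis
    using analytic_at_imp_has_fps_expansion_0 by metis
qed

lemma phi_has_fps_expansion: "phi N \<tau> w m has_fps_expansion Abs_fps (c_coeff N \<tau> w m)"
proof -
  have "phi N \<tau> w m analytic_on {0}"
    unfolding phi_def by (intro analytic_intros) auto
  moreover have "Abs_fps (c_coeff N \<tau> w m) = fps_expansion (phi N \<tau> w m) 0"
    by (simp add: fps_eq_iff c_coeff_def)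
  ultimately show ?thesis
    using analytic_at_imp_has_fps_expansion_0 by metis
qed

end

theory Submission
  imports Defs "HOL-Real_Asymp.Real_Asymp"
begin

text \<open>
  The generating function is a product of powers whose only singularities are the points
  1 / w_m, and the growth of its coefficients is governed by its behaviour there (Darboux's
  method). Near 1 / w_m, in the variable u = 1 - w_m z, the function equals
  A_m u^(-tau_m) phi_m(u), so expanding phi_m in powers of u gives singular terms
  A_m c_r u^(r - tau_m), whose n-th coefficient in z is exactly A_m c_r (tau_m - r)_n / n! w_m^n.
  Subtracting enough of these terms leaves a remainder whose coefficients are small.

  If no exponent is of non-integer type, the generating function is rational. Subtracting the
  principal parts of all poles leaves an entire function of polynomial growth, that is, a
  polynomial, so the formula is exact from some n on (lemma coeff_rational_case).

  Otherwise let m0 be an index of non-integer type that maximises first the modulus of w_m0 and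
  then the real part of tau_m0, and put a = |w_m0|. Every e_{m,r} may be chosen at will within its
  bound, and (tau_m0)_n / n! has exact order n^(Re tau_m0 - 1) and never vanishes. So the whole
  discrepancy between the two sides can be charged to e_{m0,0} and all other errors can be zero,
  as soon as that discrepancy is O(a^n n^(Re tau_m0 - 2)) (lemma absorb_error). By the choice of
  m0, all terms with |w_m| < a and, at the indices of non-integer type with |w_m| = a, the terms
  with r >= 1 are within this bound, which is why the K_m are arbitrary. The poles with |w_m| >= a, on the other hand, must be subtracted
  exactly.

  What remains is an estimate on the disc |z| < 1/a. The remainder, after removing its removable
  singularities at the poles, is holomorphic there, and near each branch point on the boundary it is a
  power u^s with Re s >= p times an analytic function, plus an analytic function. Hence its p-th
  derivative is bounded on the disc, and Cauchy's inequality gives coefficients of size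
  O(a^n n^(-p)) (lemma coeff_minus_sing_coeffs_bigo).

  The principal branches cause no trouble: on the closed disc |z| <= 1/a one has
  |w_j z| <= 1 for every j of non-integer type, so 1 - w_j z, away from its zero, has positive
  real part, while for integer exponents the power is single-valued.
\<close>

section \<open>Principal powers of affine functions\<close>

text \<open>
  The three ways in which a factor is regular at a point: a polynomial (a positive power, so that
  the convention 0 powr s = 0 agrees with the value of the polynomial at its zero), an integer
  power away from its zero, or a principal power of a number off the cut.
\<close>
lemma analytic_at_affine_powr:
  fixes w s z0 :: complex
  assumes "s \<in> \<nat> - {0} \<or> w * z0 \<noteq> 1 \<and> (s \<in> \<int> \<or> norm (w * z0) \<le> 1)"
  shows "(\<lambda>z. (1 - w * z) powr s) analytic_on {z0}"
  using assms
proof (elim disjE conjE)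
  assume "s \<in> \<nat> - {0}"
  then obtain n where n: "s = of_nat n" "n \<noteq> 0" by (auto elim: Nats_cases)
  have "(\<lambda>z. (1 - w * z) powr s) = (\<lambda>z. (1 - w * z) ^ n)"
    using n by (simp add: powr_nat')
  thus ?thesis by (auto intro!: analytic_intros)
next
  assume nz: "w * z0 \<noteq> 1" and "s \<in> \<int>"
  then obtain n where n: "s = of_int n" by (auto elim: Ints_cases)
  have "\<forall>\<^sub>F z in nhds z0. 1 - w * z \<noteq> 0"
  proof -
    have "open {z. 1 - w * z \<noteq> 0}" by (intro open_Collect_neq continuous_intros)
    from eventually_nhds_in_open[OF this, of z0] nz show ?thesis by auto
  qed
  hence "\<forall>\<^sub>F z in nhds z0. (1 - w * z) powi n = (1 - w * z) powr s"
    by eventually_elim (simp add: n complex_powr_of_int)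
  moreover have "(\<lambda>z. (1 - w * z) powi n) analytic_on {z0}"
    using nz by (auto intro!: analytic_intros)
  ultimately show ?thesis by (simp add: analytic_at_cong)
next
  assume nz: "w * z0 \<noteq> 1" and le: "norm (w * z0) \<le> 1"
  have "1 - w * z0 \<notin> \<real>\<^sub>\<le>\<^sub>0"
  proof
    assume "1 - w * z0 \<in> \<real>\<^sub>\<le>\<^sub>0"
    then obtain x where x: "1 - w * z0 = of_real x" "x \<le> 0" by (auto elim: nonpos_Reals_cases)
    hence "w * z0 = of_real (1 - x)" by (simp add: algebra_simps)
    with le x have "x = 0" by (simp only: norm_of_real)
    with x nz show False by simp
  qed
  thus ?thesis by (auto intro!: analytic_intros)
qed

lemma Re_one_minus_pos:
  assumes "norm z \<le> 1" "z \<noteq> (1::complex)"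
  shows "0 < Re (1 - z)"
proof (rule ccontr)
  assume *: "\<not> 0 < Re (1 - z)"
  have "Re z \<le> 1" using assms(1) complex_Re_le_cmod order_trans by blast
  hence "Re z = 1" using * by simp
  with assms(1) have "Im z = 0" 
    using cmod_power2[of z] power_mono[of "cmod z" 1 2] by simp
  with \<open>Re z = 1\<close> assms(2) show False by (simp add: complex_eq_iff)
qed

text \<open>
  Principal powers are multiplicative only when the arguments do not add up past the cut. Two
  numbers in the right half-plane are safe, and so are integer exponents.
\<close>
lemma powr_mult_near_one:
  fixes a s :: complex
  assumes "a \<noteq> 0" "s \<in> \<int> \<or> 0 < Re a"
  shows "\<forall>\<^sub>F x in nhds 1. (a * x) powr s = a powr s * x powr s"
proof -
  have "\<forall>\<^sub>F x in nhds (1::complex). x \<in> {x. 0 < Re x}"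
    by (intro eventually_nhds_in_open open_halfspace_Re_gt) auto
  thus ?thesis
  proof eventually_elim
    case (elim x)
    hence x: "x \<noteq> 0" "0 < Re x" by auto
    show ?case
    proof (cases "s \<in> \<int>")
      case True
      then obtain n where n: "s = of_int n" by (auto elim: Ints_cases)
      show ?thesis using x assms by (simp add: n complex_powr_of_int power_int_mult_distrib)
    next
      case False
      hence "0 < Re a" using assms by auto
      hence "\<bar>Im (Ln a)\<bar> < pi / 2" "\<bar>Im (Ln x)\<bar> < pi / 2"
        using x Re_Ln_pos_lt_imp by auto
      hence "Ln (a * x) = Ln a + Ln x"
        using x assms by (intro Ln_times_simple) auto
      thus ?thesis using x assms by (simp add: powr_def ring_distribs exp_add)
    qed
  qed
qed

lemma affine_powr_has_fps_expansion:
  "(\<lambda>z::complex. (1 - w * z) powr (- a)) has_fps_expansion Abs_fps (\<lambda>n. w ^ n * (pochhammer a n / fact n))"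
proof -
  have "(\<lambda>z. - w * z) has_fps_expansion fps_const (- w) * fps_X"
    by (intro fps_expansion_intros)
  hence "((\<lambda>x. (1 + x) powr (- a)) \<circ> (\<lambda>z. - w * z)) has_fps_expansion
      fps_compose (fps_binomial (- a)) (fps_const (- w) * fps_X)"
    by (intro has_fps_expansion_compose has_fps_expansion_binomial_complex) auto
  moreover have "fps_compose (fps_binomial (- a)) (fps_const (- w) * fps_X) = 
      Abs_fps (\<lambda>n. w ^ n * (pochhammer a n / fact n))"
  proof (rule fps_ext)
    fix n
    have "(- w) ^ n * (- 1) ^ n = w ^ n" by (simp flip: power_mult_distrib)
    thus "fps_nth (fps_compose (fps_binomial (- a)) (fps_const (- w) * fps_X)) n =
        fps_nth (Abs_fps (\<lambda>n. w ^ n * (pochhammer a n / fact n))) n"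
      by (simp add: fps_compose_linear gbinomial_pochhammer flip: mult.assoc)
  qed
  ultimately show ?thesis by (simp add: o_def)
qed

section \<open>Boundedness of higher derivatives near a branch point\<close>

lemma eventually_analytic_at:
  assumes "f analytic_on {z}"
  shows "\<forall>\<^sub>F x in nhds z. f analytic_on {x}"
proof -
  from assms obtain S where "open S" "z \<in> S" "f holomorphic_on S" by (auto simp: analytic_at)
  thus ?thesis by (auto simp: eventually_nhds analytic_at)
qed

lemma analytic_at_bounded_near:
  assumes "f analytic_on {z0}"
  shows "\<exists>B. \<forall>\<^sub>F z in nhds z0. norm (f z) \<le> B"
proof -
  have "(f \<longlongrightarrow> f z0) (nhds z0)"
    using analytic_at_imp_isCont[OF assms] by (simp add: isCont_def tendsto_nhds_iff)
  hence "((\<lambda>z. norm (f z)) \<longlongrightarrow> norm (f z0)) (nhds z0)" by (rule tendsto_norm)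
  hence "\<forall>\<^sub>F z in nhds z0. norm (f z) < norm (f z0) + 1"
    by (rule order_tendstoD) simp
  hence "\<forall>\<^sub>F z in nhds z0. norm (f z) \<le> norm (f z0) + 1"
    by eventually_elim simp
  thus ?thesis by blast
qed

lemma norm_powr_le:
  fixes x t :: complex
  assumes "norm x \<le> 2" "0 \<le> Re t"
  shows "norm (x powr t) \<le> 2 powr Re t * exp (\<bar>Im t\<bar> * pi)"
proof -
  have "\<bar>Arg x\<bar> \<le> pi" using Arg_bounded[of x] by auto
  hence "- Im t * Arg x \<le> \<bar>Im t\<bar> * pi"
  proof -
    have "- Im t * Arg x \<le> \<bar>- Im t * Arg x\<bar>" by simp
    also have "\<dots> = \<bar>Im t\<bar> * \<bar>Arg x\<bar>" by (simp add: abs_mult)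
    finally show ?thesis using \<open>\<bar>Arg x\<bar> \<le> pi\<close> by (meson abs_ge_zero mult_left_mono order_trans)
  qed
  thus ?thesis unfolding norm_powr_complex
    using assms by (intro mult_mono powr_mono2) auto
qed

text \<open>
  Each differentiation lowers the exponent by one and keeps a cofactor that is analytic at the
  branch point itself. The identity is confined to |w z| < 1, where the principal power
  is differentiable.
\<close>
lemma higher_deriv_affine_powr_mult:
  fixes w s z0 :: complex
  assumes "g analytic_on {z0}" and w: "w * z0 = 1"
  shows "\<exists>G. G analytic_on {z0} \<and> (\<forall>\<^sub>F z in nhds z0. norm (w * z) < 1 \<longrightarrow>
      (deriv ^^ p) (\<lambda>z. (1 - w * z) powr s * g z) z = (1 - w * z) powr (s - of_nat p) * G z)"
proof (induction p)
  case 0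
  show ?case using assms(1) by (intro exI[of _ g]) auto
next
  case (Suc p)
  then obtain G where G: "G analytic_on {z0}" and
    ev: "\<forall>\<^sub>F z in nhds z0. norm (w * z) < 1 \<longrightarrow>
      (deriv ^^ p) (\<lambda>z. (1 - w * z) powr s * g z) z = (1 - w * z) powr (s - of_nat p) * G z"
    by blast
  define G' where "G' = (\<lambda>z. - w * (s - of_nat p) * G z + (1 - w * z) * deriv G z)"
  have "G' analytic_on {z0}"
    unfolding G'_def using G by (intro analytic_intros analytic_deriv) auto
  moreover have "\<forall>\<^sub>F z in nhds z0. norm (w * z) < 1 \<longrightarrow>
      (deriv ^^ Suc p) (\<lambda>z. (1 - w * z) powr s * g z) z = (1 - w * z) powr (s - of_nat (Suc p)) * G' z"
  proof -
    have "\<forall>\<^sub>F z in nhds z0. G analytic_on {z}"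
      using G by (simp add: eventually_analytic_at)
    moreover from ev have "\<forall>\<^sub>F z in nhds z0. \<forall>\<^sub>F y in nhds z. norm (w * y) < 1 \<longrightarrow>
        (deriv ^^ p) (\<lambda>z. (1 - w * z) powr s * g z) y = (1 - w * y) powr (s - of_nat p) * G y"
      by (simp add: eventually_eventually)
    ultimately show ?thesis
    proof eventually_elim
      case (elim z)
      show ?case
      proof
        assume z: "norm (w * z) < 1"
        have "open {y. norm (w * y) < 1}" by (intro open_Collect_less continuous_intros)
        from eventually_nhds_in_open[OF this, of z] z have "\<forall>\<^sub>F y in nhds z. norm (w * y) < 1" by simp
        with elim(2) have "\<forall>\<^sub>F y in nhds z. (deriv ^^ p) (\<lambda>z. (1 - w * z) powr s * g z) y =
            (1 - w * y) powr (s - of_nat p) * G y"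
          by eventually_elim auto
        hence "(deriv ^^ Suc p) (\<lambda>z. (1 - w * z) powr s * g z) z =
            deriv (\<lambda>y. (1 - w * y) powr (s - of_nat p) * G y) z"
          by (auto intro: deriv_cong_ev)
        also have "\<dots> = (1 - w * z) powr (s - of_nat (Suc p)) * G' z"
        proof (rule DERIV_imp_deriv)
          define t where "t = s - of_nat p"
          have "Re (w * z) < 1" using z complex_Re_le_cmod[of "w * z"] by linarith
          hence nr: "1 - w * z \<notin> \<real>\<^sub>\<le>\<^sub>0" and nz: "1 - w * z \<noteq> 0"
            by (auto simp: complex_nonpos_Reals_iff complex_eq_iff)
          have "((\<lambda>y. (1 - w * y) powr t) has_field_derivative (t * (1 - w * z) powr (t - 1) * (- w))) (at z)"
            by (rule DERIV_chain2[where f = "\<lambda>x. x powr t" and g = "\<lambda>y. 1 - w * y"])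
               (auto intro!: derivative_eq_intros has_field_derivative_powr nr)
          moreover have "(G has_field_derivative deriv G z) (at z)"
            using elim(1) by (rule analytic_derivI)
          ultimately have "((\<lambda>y. (1 - w * y) powr t * G y) has_field_derivative
              t * (1 - w * z) powr (t - 1) * (- w) * G z + deriv G z * (1 - w * z) powr t) (at z)"
            by (rule DERIV_mult)
          moreover have "(1 - w * z) powr t = (1 - w * z) powr (t - 1) * (1 - w * z)"
            using nz powr_add[of "1 - w * z" "t - 1" 1] by simp
          hence "t * (1 - w * z) powr (t - 1) * (- w) * G z + deriv G z * (1 - w * z) powr t =
              (1 - w * z) powr (t - 1) * G' z"
            by (simp add: G'_def t_def ring_distribs mult_ac)
          ultimately show "((\<lambda>y. (1 - w * y) powr (s - of_nat p) * G y) has_field_derivative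
              (1 - w * z) powr (s - of_nat (Suc p)) * G' z) (at z)"
            by (simp add: t_def diff_diff_eq add.commute)
        qed
        finally show "(deriv ^^ Suc p) (\<lambda>z. (1 - w * z) powr s * g z) z =
          (1 - w * z) powr (s - of_nat (Suc p)) * G' z" .
      qed
    qed
  qed
  ultimately show ?case by blast
qed

text \<open>
  With at least p units of real part in the exponent, p derivatives still leave a nonnegative
  power, which is bounded up to the branch point.
\<close>
lemma higher_deriv_bounded_near_branch_point:
  fixes w s z0 :: complex
  assumes w: "w * z0 = 1" and s: "real p \<le> Re s"
    and g: "g1 analytic_on {z0}" "g2 analytic_on {z0}"
    and eq: "\<forall>\<^sub>F z in nhds z0. norm z < norm z0 \<longrightarrow> h z = (1 - w * z) powr s * g1 z + g2 z"
  shows "\<exists>B. \<forall>\<^sub>F z in nhds z0. norm z < norm z0 \<longrightarrow> norm ((deriv ^^ p) h z) \<le> B"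
proof -
  obtain G where G: "G analytic_on {z0}" and
    evG: "\<forall>\<^sub>F z in nhds z0. norm (w * z) < 1 \<longrightarrow>
      (deriv ^^ p) (\<lambda>z. (1 - w * z) powr s * g1 z) z = (1 - w * z) powr (s - of_nat p) * G z"
    using higher_deriv_affine_powr_mult[OF g(1) w, of p s] by blast
  obtain B1 where B1: "\<forall>\<^sub>F z in nhds z0. norm (G z) \<le> B1"
    using analytic_at_bounded_near[OF G] by blast
  obtain B2 where B2: "\<forall>\<^sub>F z in nhds z0. norm ((deriv ^^ p) g2 z) \<le> B2"
    using analytic_at_bounded_near[OF analytic_higher_deriv[OF g(2)]] by blast
  let ?C = "2 powr Re (s - of_nat p) * exp (\<bar>Im (s - of_nat p)\<bar> * pi)"
  have "\<forall>\<^sub>F z in nhds z0. g1 analytic_on {z}" "\<forall>\<^sub>F z in nhds z0. g2 analytic_on {z}"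
    using g by (simp_all add: eventually_analytic_at)
  moreover have "\<forall>\<^sub>F z in nhds z0. \<forall>\<^sub>F y in nhds z.
      norm y < norm z0 \<longrightarrow> h y = (1 - w * y) powr s * g1 y + g2 y"
    using eq by (simp add: eventually_eventually)
  ultimately have "\<forall>\<^sub>F z in nhds z0. norm z < norm z0 \<longrightarrow> norm ((deriv ^^ p) h z) \<le> ?C * B1 + B2"
    using evG B1 B2
  proof eventually_elim
    case (elim z)
    show ?case
    proof
      assume z: "norm z < norm z0"
      have "norm w * norm z0 = 1" using w by (metis norm_mult norm_one)
      moreover have "w \<noteq> 0" using w by auto
      ultimately have wz: "norm (w * z) < 1"
        using z by (metis mult_strict_left_mono norm_mult zero_less_norm_iff)
      have "Re (w * z) < 1" using wz complex_Re_le_cmod[of "w * z"] by linarith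
      hence nr: "1 - w * z \<notin> \<real>\<^sub>\<le>\<^sub>0" by (auto simp: complex_nonpos_Reals_iff)
      have "open {y. norm y < norm z0}" by (intro open_Collect_less continuous_intros)
      from eventually_nhds_in_open[OF this, of z] z have "\<forall>\<^sub>F y in nhds z. norm y < norm z0" by simp
      with elim(3) have "\<forall>\<^sub>F y in nhds z. h y = (1 - w * y) powr s * g1 y + g2 y"
        by eventually_elim auto
      hence "(deriv ^^ p) h z = (deriv ^^ p) (\<lambda>y. (1 - w * y) powr s * g1 y + g2 y) z"
        by (rule higher_deriv_cong_ev) simp
      also have "\<dots> = (deriv ^^ p) (\<lambda>y. (1 - w * y) powr s * g1 y) z + (deriv ^^ p) g2 z"
        using elim(1,2) nr by (intro higher_deriv_add_at analytic_intros) auto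
      also have "(deriv ^^ p) (\<lambda>y. (1 - w * y) powr s * g1 y) z = (1 - w * z) powr (s - of_nat p) * G z"
        using elim(4) wz by blast
      also have "norm ((1 - w * z) powr (s - of_nat p) * G z + (deriv ^^ p) g2 z) \<le> ?C * B1 + B2"
      proof (intro order_trans[OF norm_triangle_ineq] add_mono)
        have "norm (1 - w * z) \<le> 2" using wz norm_triangle_ineq4[of 1 "w * z"] by simp
        moreover have "0 \<le> Re (s - of_nat p)" using s by simp
        ultimately have "norm ((1 - w * z) powr (s - of_nat p)) \<le> ?C" by (rule norm_powr_le)
        thus "norm ((1 - w * z) powr (s - of_nat p) * G z) \<le> ?C * B1"
          unfolding norm_mult using elim(5) by (intro mult_mono) auto
      qed (rule elim(6))
      finally show "norm ((deriv ^^ p) h z) \<le> ?C * B1 + B2" .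
    qed
  qed
  thus ?thesis by blast
qed

text \<open>
  Compactness of the closed disc. The local bounds concern only points of the open disc, since the
  function need not be bounded, or meaningful, beyond the boundary.
\<close>
lemma bounded_on_ball_if_locally_bounded:
  fixes g :: "complex \<Rightarrow> complex"
  assumes "\<And>z0. z0 \<in> cball 0 \<rho> \<Longrightarrow> \<exists>B. \<forall>\<^sub>F z in nhds z0. norm z < \<rho> \<longrightarrow> norm (g z) \<le> B"
  shows "\<exists>B. \<forall>z\<in>ball 0 \<rho>. norm (g z) \<le> B"
proof -
  have "\<exists>UB. \<forall>z0\<in>cball 0 \<rho>. open (fst (UB z0)) \<and> z0 \<in> fst (UB z0) \<and>
      (\<forall>z\<in>fst (UB z0). norm z < \<rho> \<longrightarrow> norm (g z) \<le> snd (UB z0))"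
    using assms unfolding eventually_nhds by (intro bchoice) fastforce
  then obtain UB where UB0: "\<forall>z0\<in>cball 0 \<rho>. open (fst (UB z0)) \<and> z0 \<in> fst (UB z0) \<and>
      (\<forall>z\<in>fst (UB z0). norm z < \<rho> \<longrightarrow> norm (g z) \<le> snd (UB z0))" ..
  define U B where "U = fst \<circ> UB" and "B = snd \<circ> UB"
  have UB: "\<And>z0. z0 \<in> cball 0 \<rho> \<Longrightarrow> open (U z0)" "\<And>z0. z0 \<in> cball 0 \<rho> \<Longrightarrow> z0 \<in> U z0"
      "\<And>z0 z. z0 \<in> cball 0 \<rho> \<Longrightarrow> z \<in> U z0 \<Longrightarrow> norm z < \<rho> \<Longrightarrow> norm (g z) \<le> B z0"
    using UB0 by (simp_all add: U_def B_def del: mem_cball)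
  obtain C where C: "C \<subseteq> cball 0 \<rho>" "finite C" "cball 0 \<rho> \<subseteq> (\<Union>c\<in>C. U c)"
  proof (rule compactE_image[OF compact_cball, of "cball 0 \<rho>" U 0 \<rho>])
    show "cball 0 \<rho> \<subseteq> (\<Union>c\<in>cball 0 \<rho>. U c)" using UB(2) by (intro subsetI UN_I)
  qed (use UB(1) in auto)
  have "norm (g z) \<le> (\<Sum>c\<in>C. \<bar>B c\<bar>)" if "z \<in> ball 0 \<rho>" for z
  proof -
    from that have "z \<in> cball 0 \<rho>" by simp
    with C(3) obtain c where c: "c \<in> C" "z \<in> U c" by blast
    hence "norm (g z) \<le> B c" using UB(3)[of c z] C(1) that by (simp add: subset_iff)
    also have "\<dots> \<le> \<bar>B c\<bar>" by simp
    also have "\<dots> \<le> (\<Sum>c\<in>C. \<bar>B c\<bar>)" using C c by (intro member_le_sum) auto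
    finally show ?thesis .
  qed
  thus ?thesis by blast
qed

section \<open>Coefficient bounds from Cauchy's inequality\<close>

lemma fact_add_ge: "(real n + 1) ^ p * fact n \<le> fact (n + p)"
proof (induction p)
  case (Suc p)
  have "(real n + 1) ^ Suc p * fact n = (real n + 1) * ((real n + 1) ^ p * fact n)" by simp
  also have "\<dots> \<le> (real n + 1 + real p) * fact (n + p)"
    using Suc.IH by (intro mult_mono) auto
  also have "\<dots> = fact (n + Suc p)" by (simp add: algebra_simps)
  finally show ?case .
qed auto

text \<open>
  Cauchy's inequality on circles of radius tending to \<open>\<rho>\<close> bounds the coefficients of the p-th
  derivative by a multiple of \<open>\<rho>\<close>^(-n). Those coefficients are those of h shifted by p and
  multiplied by (n + p)! / n!, and this factor provides the gain n^(-p).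
\<close>
lemma coeff_bigo_if_higher_deriv_bounded:
  assumes hol: "h holomorphic_on ball 0 \<rho>" and \<rho>: "0 < \<rho>" and H: "h has_fps_expansion H"
    and B: "\<And>z. z \<in> ball 0 \<rho> \<Longrightarrow> norm ((deriv ^^ p) h z) \<le> B"
  shows "(\<lambda>n. norm (fps_nth H n)) \<in> O(\<lambda>n. (1 / \<rho>) ^ n * real n powr (- real p))"
proof -
  have holp: "(deriv ^^ p) h holomorphic_on ball 0 \<rho>"
    by (intro holomorphic_higher_deriv hol open_ball)
  have B0: "0 \<le> B" using order_trans[OF norm_ge_zero B[of 0]] \<rho> by simp
  have bound: "norm (fps_nth H (n + p)) \<le> fact n * B / \<rho> ^ n / fact (n + p)" for n
  proof -
    have le: "norm ((deriv ^^ n) ((deriv ^^ p) h) 0) \<le> fact n * B / r ^ n" if r: "0 < r" "r < \<rho>" for r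
    proof (rule Cauchy_inequality)
      have sub: "cball (0::complex) r \<subseteq> ball 0 \<rho>" using r by auto
      show "(deriv ^^ p) h holomorphic_on ball 0 r"
        using holp sub ball_subset_cball holomorphic_on_subset by blast
      show "continuous_on (cball 0 r) ((deriv ^^ p) h)"
        using holp sub holomorphic_on_imp_continuous_on continuous_on_subset by blast
    qed (use r B in auto)
    have "norm ((deriv ^^ n) ((deriv ^^ p) h) 0) \<le> fact n * B / \<rho> ^ n"
    proof (rule tendsto_lowerbound)
      show "((\<lambda>r. fact n * B / r ^ n) \<longlongrightarrow> fact n * B / \<rho> ^ n) (at_left \<rho>)"
        using \<rho> by (intro tendsto_intros) auto
      have "\<forall>\<^sub>F r in at_left \<rho>. r \<in> {0<..<\<rho>}" using \<rho> by (intro eventually_at_left_real)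
      thus "\<forall>\<^sub>F r in at_left \<rho>. norm ((deriv ^^ n) ((deriv ^^ p) h) 0) \<le> fact n * B / r ^ n"
        by eventually_elim (use le in auto)
    qed auto
    moreover have "fps_nth H (n + p) = (deriv ^^ n) ((deriv ^^ p) h) 0 / fact (n + p)"
      using fps_nth_fps_expansion[OF H, of "n + p"] by (simp add: funpow_add)
    ultimately show ?thesis by (simp only: norm_divide norm_fact) (rule divide_right_mono, simp_all)
  qed
  show ?thesis
  proof (rule bigoI[of _ "B * \<rho> ^ p * real (p + 1) ^ p"])
    show "\<forall>\<^sub>F n in sequentially. norm (norm (fps_nth H n)) \<le>
        B * \<rho> ^ p * real (p + 1) ^ p * norm ((1 / \<rho>) ^ n * real n powr (- real p))"
      using eventually_ge_at_top[of "Suc p"]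
    proof eventually_elim
      case (elim m)
      then obtain n where m: "m = n + p" "n \<ge> 1" by (intro that[of "m - p"]) auto
      \<comment> \<open>m = n + p is at most (p + 1) (n + 1), so the shift by p costs only a constant factor.\<close>
      have "fact n * real m ^ p \<le> fact n * (real (p + 1) * (real n + 1)) ^ p"
        using m by (intro mult_left_mono power_mono) (auto simp: algebra_simps)
      also have "\<dots> = real (p + 1) ^ p * ((real n + 1) ^ p * fact n)"
        by (simp only: power_mult_distrib mult_ac)
      also have "\<dots> \<le> real (p + 1) ^ p * fact m"
        unfolding m by (intro mult_left_mono fact_add_ge) auto
      finally have "fact n / fact m \<le> real (p + 1) ^ p / real m ^ p"
        using m by (simp add: field_simps)
      hence "B / \<rho> ^ n * (fact n / fact m) \<le> B / \<rho> ^ n * (real (p + 1) ^ p / real m ^ p)"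
        using B0 \<rho> by (intro mult_left_mono) auto
      moreover have "norm (fps_nth H m) \<le> B / \<rho> ^ n * (fact n / fact m)"
        using bound[of n] m by (simp add: mult_ac)
      moreover have "B / \<rho> ^ n * (real (p + 1) ^ p / real m ^ p) =
          B * \<rho> ^ p * real (p + 1) ^ p * norm ((1 / \<rho>) ^ m * real m powr (- real p))"
        using m \<rho> by (simp add: norm_mult norm_power powr_minus powr_realpow power_add field_simps)
      ultimately show ?case by simp
    qed
  qed
qed

text \<open>
  Liouville's argument: Cauchy's inequality on circles of radius tending to infinity.
\<close>
lemma coeff_eq_0_if_poly_growth:
  assumes hol: "h holomorphic_on UNIV" and H: "h has_fps_expansion H"
    and O: "h \<in> O[at_infinity](\<lambda>z. z ^ d)" and n: "d < n"
  shows "fps_nth H n = 0"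
proof -
  from O obtain c where c: "c > 0" "\<forall>\<^sub>F z in at_infinity. norm (h z) \<le> c * norm (z ^ d)"
    by (auto elim: landau_o.bigE)
  then obtain b where b: "\<And>z. b \<le> norm z \<Longrightarrow> norm (h z) \<le> c * norm (z ^ d)"
    by (auto simp: eventually_at_infinity)
  have "norm ((deriv ^^ n) h 0) \<le> fact n * c / r" if r: "max b 1 \<le> r" for r
  proof -
    have "norm ((deriv ^^ n) h 0) \<le> fact n * (c * r ^ d) / r ^ n"
    proof (rule Cauchy_inequality)
      show "h holomorphic_on ball 0 r" "continuous_on (cball 0 r) h"
        using hol holomorphic_on_subset holomorphic_on_imp_continuous_on by blast+
    qed (use r b in \<open>auto simp: norm_power\<close>)
    also have "r ^ n = r ^ d * r ^ (n - d)" using n by (simp flip: power_add)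
    also have "fact n * (c * r ^ d) / (r ^ d * r ^ (n - d)) = fact n * c / r ^ (n - d)"
      using r by simp
    also have "\<dots> \<le> fact n * c / r"
      using r c n self_le_power[of r "n - d"] by (intro divide_left_mono mult_pos_pos) auto
    finally show ?thesis .
  qed
  hence "\<forall>\<^sub>F r in at_top. norm ((deriv ^^ n) h 0) \<le> fact n * c / r"
    using eventually_ge_at_top by (rule eventually_mono[rotated])
  moreover have "((\<lambda>r::real. fact n * c / r) \<longlongrightarrow> 0) at_top"
    by (rule tendsto_divide_0[OF tendsto_const]) (rule filterlim_at_top_imp_at_infinity[OF filterlim_ident])
  ultimately have "norm ((deriv ^^ n) h 0) \<le> 0"
    by (intro tendsto_lowerbound[of _ 0 at_top]) auto
  thus ?thesis using fps_nth_fps_expansion[OF H, of n] by simp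
qed

section \<open>Functions of polynomial growth\<close>

definition poly_growth :: "(complex \<Rightarrow> complex) \<Rightarrow> bool" where
  "poly_growth f \<longleftrightarrow> (\<exists>d. f \<in> O[at_infinity](\<lambda>z. z ^ d))"

lemma poly_growth_const: "poly_growth (\<lambda>_. c)"
  unfolding poly_growth_def by (intro exI[of _ 0]) simp

lemma power_bigo_at_infinity: 
  assumes "d \<le> e"
  shows "(\<lambda>z::complex. z ^ d) \<in> O[at_infinity](\<lambda>z. z ^ e)"
proof (rule bigoI[of _ 1])
  show "\<forall>\<^sub>F z::complex in at_infinity. norm (z ^ d) \<le> 1 * norm (z ^ e)"
    unfolding eventually_at_infinity using assms
    by (intro exI[of _ 1]) (auto simp: norm_power intro: power_increasing)
qed

lemma poly_growth_mult:
  assumes "poly_growth f" "poly_growth g"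
  shows "poly_growth (\<lambda>z. f z * g z)"
proof -
  from assms obtain d e where "f \<in> O[at_infinity](\<lambda>z. z ^ d)" "g \<in> O[at_infinity](\<lambda>z. z ^ e)"
    by (auto simp: poly_growth_def)
  hence "(\<lambda>z. f z * g z) \<in> O[at_infinity](\<lambda>z. z ^ d * z ^ e)"
    by (rule landau_o.big.mult)
  thus ?thesis unfolding poly_growth_def power_add [symmetric] by blast
qed

lemma poly_growth_add:
  assumes "poly_growth f" "poly_growth g"
  shows "poly_growth (\<lambda>z. f z + g z)"
proof -
  from assms obtain d e where "f \<in> O[at_infinity](\<lambda>z. z ^ d)" "g \<in> O[at_infinity](\<lambda>z. z ^ e)"
    by (auto simp: poly_growth_def)
  hence "f \<in> O[at_infinity](\<lambda>z. z ^ max d e)" "g \<in> O[at_infinity](\<lambda>z. z ^ max d e)"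
    using power_bigo_at_infinity[of _ "max d e"] landau_o.big.trans max.cobounded1 max.cobounded2 by blast+
  thus ?thesis unfolding poly_growth_def using sum_in_bigo(1) by blast
qed

lemma poly_growth_sum: "(\<And>i. i \<in> I \<Longrightarrow> poly_growth (f i)) \<Longrightarrow> poly_growth (\<lambda>z. \<Sum>i\<in>I. f i z)"
  by (induction I rule: infinite_finite_induct) (auto intro: poly_growth_const poly_growth_add)

lemma poly_growth_prod: "(\<And>i. i \<in> I \<Longrightarrow> poly_growth (f i)) \<Longrightarrow> poly_growth (\<lambda>z. \<Prod>i\<in>I. f i z)"
  by (induction I rule: infinite_finite_induct) (auto intro: poly_growth_const poly_growth_mult)

lemma poly_growth_affine_powr:
  assumes "s \<in> \<int>" "w \<noteq> 0"
  shows "poly_growth (\<lambda>z. (1 - w * z) powr s)"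
proof -
  obtain i where s: "s = of_int i" using assms by (auto elim: Ints_cases)
  have "norm ((1 - w * z) powr s) \<le> (2 * norm w) ^ nat i * norm (z ^ nat i)" if z: "norm z \<ge> 2 / norm w" for z
  proof -
    have wz: "norm (w * z) \<ge> 2" using z assms by (simp add: norm_mult field_simps)
    hence ge: "1 \<le> norm (1 - w * z)" and le: "norm (1 - w * z) \<le> 2 * norm w * norm z"
      using norm_triangle_ineq2[of "w * z" 1] norm_triangle_ineq4[of 1 "w * z"]
      by (auto simp: norm_minus_commute norm_mult)
    have "norm ((1 - w * z) powr s) = norm (1 - w * z) powr real_of_int i"
      by (simp add: s norm_powr_real_powr')
    also have "\<dots> \<le> norm (1 - w * z) powr real (nat i)"
      using ge by (intro powr_mono) auto
    also have "\<dots> = norm (1 - w * z) ^ nat i" using ge by (intro powr_realpow) auto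
    also have "\<dots> \<le> (2 * norm w * norm z) ^ nat i" using le by (intro power_mono) auto
    finally show ?thesis by (simp add: power_mult_distrib norm_power)
  qed
  hence "\<forall>\<^sub>F z in at_infinity. norm ((1 - w * z) powr s) \<le> (2 * norm w) ^ nat i * norm (z ^ nat i)"
    unfolding eventually_at_infinity by blast
  thus ?thesis unfolding poly_growth_def by (blast intro: bigoI)
qed

section \<open>Local expansion of the generating function\<close>

lemma has_fps_expansion_taylor_remainder:
  fixes f :: "complex \<Rightarrow> complex"
  assumes "f has_fps_expansion F"
  obtains g where "g analytic_on {0}"
    "\<forall>\<^sub>F u in nhds 0. f u = (\<Sum>r<L. fps_nth F r * u ^ r) + u ^ L * g u"
proof -
  let ?g = "eval_fps (fps_shift L F)"
  have R: "fps_conv_radius F > 0" and ev: "\<forall>\<^sub>F u in nhds 0. eval_fps F u = f u"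
    using assms by (auto simp: has_fps_expansion_def)
  have "?g has_fps_expansion fps_shift L F"
    using R by (intro eval_fps_has_fps_expansion) auto
  hence "?g analytic_on {0}" by (rule has_fps_expansion_imp_analytic_0)
  moreover have "\<forall>\<^sub>F u in nhds 0. u \<in> eball 0 (fps_conv_radius F)"
    using R by (intro eventually_nhds_in_open) (auto simp: zero_ereal_def)
  with ev have "\<forall>\<^sub>F u in nhds 0. f u = (\<Sum>r<L. fps_nth F r * u ^ r) + u ^ L * ?g u"
  proof eventually_elim
    case (elim u)
    have "(\<lambda>n. fps_nth F n * u ^ n) sums eval_fps F u"
      using elim by (intro sums_eval_fps) auto
    hence "eval_fps F u = (\<Sum>r<L. fps_nth F r * u ^ r) + (\<Sum>n. fps_nth F (n + L) * u ^ (n + L))"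
      using suminf_split_initial_segment[of "\<lambda>n. fps_nth F n * u ^ n" L]
      by (simp add: sums_iff add.commute)
    moreover have "(\<lambda>n. fps_nth (fps_shift L F) n * u ^ n) sums ?g u"
      using elim by (intro sums_eval_fps) auto
    hence "(\<lambda>n. u ^ L * (fps_nth (fps_shift L F) n * u ^ n)) sums (u ^ L * ?g u)"
      by (rule sums_mult)
    hence "(\<Sum>n. fps_nth F (n + L) * u ^ (n + L)) = u ^ L * ?g u"
      by (simp add: sums_iff power_add mult_ac)
    ultimately show ?case using elim by simp
  qed
  ultimately show ?thesis by (rule that)
qed

text \<open>
  The identity behind both A_m and phi_m is
  1 - w_j z = (1 - w_j / w_m) (1 - w_j / (w_j - w_m) (1 - w_m z)).
  The assumption on the moduli makes 1 - w_j / w_m lie in the right half-plane for every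
  non-integer exponent. Without it, the point 1 / w_m may lie on the cut of the j-th factor.
\<close>
lemma gen_fun_eq_near:
  assumes m: "m \<le> N" and w: "\<And>j. j \<le> N \<Longrightarrow> w j \<noteq> 0" and inj: "inj_on w {0..N}"
    and dom: "\<And>j. j \<le> N \<Longrightarrow> \<tau> j \<in> \<int> \<or> norm (w j) \<le> norm (w m)"
  shows "\<forall>\<^sub>F z in nhds (1 / w m). gen_fun N \<tau> w z =
           A_const N \<tau> w m * (1 - w m * z) powr (- \<tau> m) * phi N \<tau> w m (1 - w m * z)"
proof -
  have "\<forall>\<^sub>F z in nhds (1 / w m). (1 - w j * z) powr (- \<tau> j) =
      (1 - w j / w m) powr (- \<tau> j) * (1 - w j / (w j - w m) * (1 - w m * z)) powr (- \<tau> j)"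
    if j: "j \<in> {0..N} - {m}" for j
  proof -
    have ne: "w j \<noteq> w m" and wm: "w m \<noteq> 0" using j m w inj by (auto simp: inj_on_def)
    have "\<forall>\<^sub>F x in nhds 1. ((1 - w j / w m) * x) powr (- \<tau> j) = (1 - w j / w m) powr (- \<tau> j) * x powr (- \<tau> j)"
    proof (rule powr_mult_near_one)
      show "1 - w j / w m \<noteq> 0" using ne wm by simp
      show "- \<tau> j \<in> \<int> \<or> 0 < Re (1 - w j / w m)"
        using dom[of j] j ne wm Re_one_minus_pos[of "w j / w m"]
        by (auto simp: norm_divide minus_in_Ints_iff)
    qed
    moreover have "filterlim (\<lambda>z. 1 - w j / (w j - w m) * (1 - w m * z)) (nhds 1) (nhds (1 / w m))"
    proof -
      have "((\<lambda>z. 1 - w j / (w j - w m) * (1 - w m * z)) \<longlongrightarrow>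
              1 - w j / (w j - w m) * (1 - w m * (1 / w m))) (nhds (1 / w m))"
        by (intro tendsto_intros filterlim_ident)
      thus ?thesis using wm by simp
    qed
    ultimately have "\<forall>\<^sub>F z in nhds (1 / w m). ((1 - w j / w m) * (1 - w j / (w j - w m) * (1 - w m * z))) powr (- \<tau> j)
        = (1 - w j / w m) powr (- \<tau> j) * (1 - w j / (w j - w m) * (1 - w m * z)) powr (- \<tau> j)"
      by (rule eventually_compose_filterlim)
    moreover have "(1 - w j / w m) * (1 - w j / (w j - w m) * (1 - w m * z)) = 1 - w j * z" for z
      using ne wm by (simp add: field_simps)
    ultimately show ?thesis by simp
  qed
  hence "\<forall>\<^sub>F z in nhds (1 / w m). \<forall>j\<in>{0..N} - {m}. (1 - w j * z) powr (- \<tau> j) =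
      (1 - w j / w m) powr (- \<tau> j) * (1 - w j / (w j - w m) * (1 - w m * z)) powr (- \<tau> j)"
    by (intro eventually_ball_finite) auto
  thus ?thesis
  proof eventually_elim
    case (elim z)
    have "gen_fun N \<tau> w z = (1 - w m * z) powr (- \<tau> m) * (\<Prod>j\<in>{0..N} - {m}. (1 - w j * z) powr (- \<tau> j))"
      unfolding gen_fun_def using m by (subst prod.remove[of _ m]) auto
    also have "(\<Prod>j\<in>{0..N} - {m}. (1 - w j * z) powr (- \<tau> j)) = A_const N \<tau> w m * phi N \<tau> w m (1 - w m * z)"
      unfolding A_const_def phi_def prod.distrib[symmetric] using elim by (intro prod.cong) auto
    finally show ?case by (simp add: mult_ac)
  qed
qed

lemma c_coeff_0: "c_coeff N \<tau> w m 0 = 1"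
  using has_fps_expansion_imp_0_eq_fps_nth_0[OF phi_has_fps_expansion[of N \<tau> w m]]
  by (simp add: phi_def)

lemma A_const_nonzero:
  assumes "m \<le> N" "w m \<noteq> 0" "inj_on w {0..N}"
  shows "A_const N \<tau> w m \<noteq> 0"
  using assms unfolding A_const_def by (auto simp: inj_on_def)

text \<open>
  The contribution of the Taylor term c_r u^r of phi_m, at u = 1 - w_m z, to the generating function
  near 1 / w_m. The exponent is written with tau_m - r, since this is the Pochhammer parameter of
  its Maclaurin coefficients.
\<close>
definition sing_term :: "nat \<Rightarrow> (nat \<Rightarrow> complex) \<Rightarrow> (nat \<Rightarrow> complex) \<Rightarrow> nat \<Rightarrow> nat \<Rightarrow> complex \<Rightarrow> complex" where
  "sing_term N \<tau> w m r z = A_const N \<tau> w m * c_coeff N \<tau> w m r * (1 - w m * z) powr (- (\<tau> m - of_nat r))"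

definition sing_coeff :: "nat \<Rightarrow> (nat \<Rightarrow> complex) \<Rightarrow> (nat \<Rightarrow> complex) \<Rightarrow> nat \<Rightarrow> nat \<Rightarrow> nat \<Rightarrow> complex" where
  "sing_coeff N \<tau> w m r n = A_const N \<tau> w m * c_coeff N \<tau> w m r * (pochhammer (\<tau> m - of_nat r) n / fact n) * w m ^ n"

definition remainder where
  "remainder N \<tau> w S L z = gen_fun N \<tau> w z - (\<Sum>m\<in>S. \<Sum>r<L m. sing_term N \<tau> w m r z)"

lemma sing_term_has_fps_expansion:
  "sing_term N \<tau> w m r has_fps_expansion Abs_fps (sing_coeff N \<tau> w m r)"
proof -
  have "(\<lambda>z. A_const N \<tau> w m * c_coeff N \<tau> w m r * (1 - w m * z) powr (- (\<tau> m - of_nat r)))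
      has_fps_expansion fps_const (A_const N \<tau> w m * c_coeff N \<tau> w m r) *
        Abs_fps (\<lambda>n. w m ^ n * (pochhammer (\<tau> m - of_nat r) n / fact n))"
    by (intro has_fps_expansion_cmult_left affine_powr_has_fps_expansion)
  moreover have "fps_const (A_const N \<tau> w m * c_coeff N \<tau> w m r) *
        Abs_fps (\<lambda>n. w m ^ n * (pochhammer (\<tau> m - of_nat r) n / fact n)) = Abs_fps (sing_coeff N \<tau> w m r)"
    by (rule fps_ext) (simp add: sing_coeff_def mult_ac)
  ultimately show ?thesis by (simp add: sing_term_def[abs_def])
qed

lemma remainder_has_fps_expansion:
  "remainder N \<tau> w S L has_fps_expansion
     Abs_fps (\<lambda>n. G_coeff N \<tau> w n - (\<Sum>m\<in>S. \<Sum>r<L m. sing_coeff N \<tau> w m r n))"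
proof -
  have "remainder N \<tau> w S L has_fps_expansion
      Abs_fps (G_coeff N \<tau> w) - (\<Sum>m\<in>S. \<Sum>r<L m. Abs_fps (sing_coeff N \<tau> w m r))"
    unfolding remainder_def[abs_def]
    by (intro has_fps_expansion_diff has_fps_expansion_sum gen_fun_has_fps_expansion sing_term_has_fps_expansion)
  also have "Abs_fps (G_coeff N \<tau> w) - (\<Sum>m\<in>S. \<Sum>r<L m. Abs_fps (sing_coeff N \<tau> w m r)) =
      Abs_fps (\<lambda>n. G_coeff N \<tau> w n - (\<Sum>m\<in>S. \<Sum>r<L m. sing_coeff N \<tau> w m r n))"
    by (rule fps_ext) (simp add: fps_sum_nth)
  finally show ?thesis .
qed

lemma sing_term_analytic_at:
  assumes "w m * z0 \<noteq> 1" "\<tau> m \<in> \<int> \<or> norm (w m * z0) \<le> 1"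
  shows "sing_term N \<tau> w m r analytic_on {z0}"
proof -
  have "- (\<tau> m - of_nat r) \<in> \<int>" if "\<tau> m \<in> \<int>" using that by (simp only: minus_in_Ints_iff Ints_diff Ints_of_nat)
  thus ?thesis unfolding sing_term_def[abs_def]
    using assms by (intro analytic_intros analytic_at_affine_powr) auto
qed

lemma remainder_analytic_at:
  assumes S: "S \<subseteq> {0..N}"
    and "\<And>j. j \<le> N \<Longrightarrow> j \<notin> S \<Longrightarrow> - \<tau> j \<in> \<nat> - {0} \<or> w j * z0 \<noteq> 1 \<and> (\<tau> j \<in> \<int> \<or> norm (w j * z0) \<le> 1)"
    and "\<And>j. j \<in> S \<Longrightarrow> w j * z0 \<noteq> 1 \<and> (\<tau> j \<in> \<int> \<or> norm (w j * z0) \<le> 1)"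
  shows "remainder N \<tau> w S L analytic_on {z0}"
proof -
  have "(\<lambda>z. (1 - w j * z) powr (- \<tau> j)) analytic_on {z0}" if "j \<in> {0..N}" for j
    using assms(2)[of j] assms(3)[of j] that
    by (intro analytic_at_affine_powr) (auto simp: minus_in_Ints_iff)
  hence "gen_fun N \<tau> w analytic_on {z0}"
    unfolding gen_fun_def[abs_def] by (rule analytic_on_prod)
  moreover have "sing_term N \<tau> w m r analytic_on {z0}" if "m \<in> S" for m r
    using assms(3)[OF that] by (intro sing_term_analytic_at) auto
  ultimately show ?thesis
    unfolding remainder_def[abs_def] by (intro analytic_intros)
qed

text \<open>
  The remainder of the Taylor expansion of phi_m is u^L times an analytic function, so removing L
  singular terms raises the exponent by L. The equation also holds at z = 1 / w_m,
  where both sides are 0 because 0 powr s = 0 for all s.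
\<close>
lemma gen_fun_minus_sing_terms_near:
  assumes m: "m \<le> N" and w: "\<And>j. j \<le> N \<Longrightarrow> w j \<noteq> 0" and inj: "inj_on w {0..N}"
    and dom: "\<And>j. j \<le> N \<Longrightarrow> \<tau> j \<in> \<int> \<or> norm (w j) \<le> norm (w m)"
  obtains g where "g analytic_on {1 / w m}"
    "\<forall>\<^sub>F z in nhds (1 / w m). gen_fun N \<tau> w z - (\<Sum>r<L. sing_term N \<tau> w m r z) =
       (1 - w m * z) powr (of_nat L - \<tau> m) * g z"
proof -
  have wm: "w m \<noteq> 0" using w m by auto
  obtain \<psi> where \<psi>: "\<psi> analytic_on {0}" and ev: "\<forall>\<^sub>F u in nhds 0. phi N \<tau> w m u =
      (\<Sum>r<L. fps_nth (Abs_fps (c_coeff N \<tau> w m)) r * u ^ r) + u ^ L * \<psi> u"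
    by (rule has_fps_expansion_taylor_remainder[OF phi_has_fps_expansion, of N \<tau> w m L]) (rule that)
  define g where "g = (\<lambda>z. A_const N \<tau> w m * \<psi> (1 - w m * z))"
  have "(\<lambda>z. \<psi> (1 - w m * z)) analytic_on {1 / w m}"
  proof -
    have "(\<lambda>z. 1 - w m * z) analytic_on {1 / w m}" by (intro analytic_intros)
    from analytic_on_compose[OF this, of \<psi>] show ?thesis using \<psi> wm by (simp add: o_def)
  qed
  hence g: "g analytic_on {1 / w m}" unfolding g_def by (intro analytic_intros)
  have "filterlim (\<lambda>z. 1 - w m * z) (nhds 0) (nhds (1 / w m))"
  proof -
    have "((\<lambda>z. 1 - w m * z) \<longlongrightarrow> 1 - w m * (1 / w m)) (nhds (1 / w m))"
      by (intro tendsto_intros filterlim_ident)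
    thus ?thesis using wm by simp
  qed
  hence "\<forall>\<^sub>F z in nhds (1 / w m). phi N \<tau> w m (1 - w m * z) =
      (\<Sum>r<L. c_coeff N \<tau> w m r * (1 - w m * z) ^ r) + (1 - w m * z) ^ L * \<psi> (1 - w m * z)"
    using eventually_compose_filterlim[OF ev] by simp
  moreover have "\<forall>\<^sub>F z in nhds (1 / w m). gen_fun N \<tau> w z =
      A_const N \<tau> w m * (1 - w m * z) powr (- \<tau> m) * phi N \<tau> w m (1 - w m * z)"
    using m w inj dom by (intro gen_fun_eq_near) auto
  ultimately have "\<forall>\<^sub>F z in nhds (1 / w m). gen_fun N \<tau> w z - (\<Sum>r<L. sing_term N \<tau> w m r z) =
       (1 - w m * z) powr (of_nat L - \<tau> m) * g z"
  proof eventually_elim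
    case (elim z)
    define u where "u = 1 - w m * z"
    show ?case
    proof (cases "u = 0")
      case True
      thus ?thesis using elim by (simp add: sing_term_def u_def)
    next
      case False
      have pw: "u powr (of_nat r - \<tau> m) = u powr (- \<tau> m) * u ^ r" for r
        using powr_add[of u "of_nat r" "- \<tau> m"] False by (simp add: powr_nat' mult.commute)
      have "sing_term N \<tau> w m r z = A_const N \<tau> w m * (u powr (- \<tau> m) * (c_coeff N \<tau> w m r * u ^ r))" for r
        unfolding sing_term_def u_def[symmetric] using pw[of r] by simp
      hence "(\<Sum>r<L. sing_term N \<tau> w m r z) =
          A_const N \<tau> w m * u powr (- \<tau> m) * (\<Sum>r<L. c_coeff N \<tau> w m r * u ^ r)"
        by (simp add: sum_distrib_left mult.assoc)
      thus ?thesis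
        using elim pw[of L] unfolding u_def[symmetric] g_def by (simp add: algebra_simps)
    qed
  qed
  with g show ?thesis by (rule that)
qed

text \<open>
  The singular terms that belong to the other points are analytic at 1 / w_m, so only the
  terms of index m interact with the singularity.
\<close>
lemma remainder_near_singularity:
  assumes S: "S \<subseteq> {0..N}" "m \<in> S" and w: "\<And>j. j \<le> N \<Longrightarrow> w j \<noteq> 0" and inj: "inj_on w {0..N}"
    and dom: "\<And>j. j \<le> N \<Longrightarrow> \<tau> j \<in> \<int> \<or> norm (w j) \<le> norm (w m)"
    and z0: "w m * z0 = 1"
  shows "\<exists>g1 g2. g1 analytic_on {z0} \<and> g2 analytic_on {z0} \<and>
    (\<forall>\<^sub>F z in nhds z0. remainder N \<tau> w S L z = (1 - w m * z) powr (of_nat (L m) - \<tau> m) * g1 z + g2 z)"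
proof -
  have fin: "finite S" using S finite_subset by blast
  have m: "m \<le> N" using S by auto
  have wm: "w m \<noteq> 0" using w m by auto
  have z0': "z0 = 1 / w m" using z0 wm by (simp add: field_simps)
  obtain g where "g analytic_on {1 / w m}" and
    "\<forall>\<^sub>F z in nhds (1 / w m). gen_fun N \<tau> w z - (\<Sum>r<L m. sing_term N \<tau> w m r z) =
       (1 - w m * z) powr (of_nat (L m) - \<tau> m) * g z"
    by (rule gen_fun_minus_sing_terms_near[OF m w inj dom, of "L m"]) (assumption | (rule that; assumption))+
  note g = this(1)[folded z0'] and ev = this(2)[folded z0']
  define g2 where "g2 = (\<lambda>z. - (\<Sum>j\<in>S-{m}. \<Sum>r<L j. sing_term N \<tau> w j r z))"
  have "sing_term N \<tau> w j r analytic_on {z0}" if "j \<in> S - {m}" for j r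
  proof (rule sing_term_analytic_at)
    have "w j \<noteq> w m" using that S inj by (auto simp: inj_on_def)
    thus "w j * z0 \<noteq> 1" using wm by (simp add: z0')
    show "\<tau> j \<in> \<int> \<or> norm (w j * z0) \<le> 1"
      using dom[of j] that S wm by (auto simp: z0' norm_mult norm_divide divide_simps)
  qed
  hence "g2 analytic_on {z0}" unfolding g2_def by (intro analytic_intros)
  moreover have "\<forall>\<^sub>F z in nhds z0. remainder N \<tau> w S L z = (1 - w m * z) powr (of_nat (L m) - \<tau> m) * g z + g2 z"
    using ev
  proof eventually_elim
    case (elim z)
    have "remainder N \<tau> w S L z = (gen_fun N \<tau> w z - (\<Sum>r<L m. sing_term N \<tau> w m r z)) + g2 z"
      unfolding remainder_def g2_def using S fin by (subst sum.remove[of S m]) auto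
    thus ?case using elim by simp
  qed
  ultimately show ?thesis using g by blast
qed

lemma remove_sings_analytic_at_if_eq_analytic:
  assumes g: "g analytic_on {z0}" and eq: "\<forall>\<^sub>F z in at z0. f z = g z"
  shows "remove_sings f analytic_on {z0}"
proof (rule remove_sings_analytic_at)
  show "isolated_singularity_at f z0"
    using isolated_singularity_at_cong[OF eq refl] isolated_singularity_at_analytic[OF g] by simp
  have "g \<midarrow>z0\<rightarrow> g z0" using analytic_at_imp_isCont[OF g] by (simp add: isCont_def)
  thus "f \<midarrow>z0\<rightarrow> g z0" using tendsto_cong[OF eq] by simp
qed

text \<open>
  At a pole of order L m, removing L m singular terms leaves the exponent 0. Because
  0 powr 0 = 0, the value of the remainder at the pole itself may still be wrong, so the
  singularity is removable rather than absent.
\<close>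
lemma remove_sings_remainder_analytic_at_pole:
  assumes S: "S \<subseteq> {0..N}" "m \<in> S" and w: "\<And>j. j \<le> N \<Longrightarrow> w j \<noteq> 0" and inj: "inj_on w {0..N}"
    and dom: "\<And>j. j \<le> N \<Longrightarrow> \<tau> j \<in> \<int> \<or> norm (w j) \<le> norm (w m)"
    and z0: "w m * z0 = 1" and L: "\<tau> m = of_nat (L m)"
  shows "remove_sings (remainder N \<tau> w S L) analytic_on {z0}"
proof -
  obtain g1 g2 where g: "g1 analytic_on {z0}" "g2 analytic_on {z0}" and
    ev: "\<forall>\<^sub>F z in nhds z0. remainder N \<tau> w S L z = (1 - w m * z) powr (of_nat (L m) - \<tau> m) * g1 z + g2 z"
    using remainder_near_singularity[OF S w inj dom z0, of L] by blast
  have "w m \<noteq> 0" using z0 by auto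
  have "\<forall>\<^sub>F z in at z0. remainder N \<tau> w S L z = g1 z + g2 z"
    unfolding eventually_at_filter using ev
  proof eventually_elim
    case (elim z)
    show ?case
    proof (intro impI)
      assume "z \<noteq> z0"
      hence "w m * z \<noteq> w m * z0" using \<open>w m \<noteq> 0\<close> by simp
      hence "(1 - w m * z) powr (of_nat (L m) - \<tau> m) = 1" using z0 L by simp
      thus "remainder N \<tau> w S L z = g1 z + g2 z" using elim by simp
    qed
  qed
  moreover have "(\<lambda>z. g1 z + g2 z) analytic_on {z0}" using g by (intro analytic_intros)
  ultimately show ?thesis by (intro remove_sings_analytic_at_if_eq_analytic)
qed

section \<open>Coefficients of the remainder\<close>

text \<open>
  With integer exponents only, the corrected remainder is entire, and it grows at most like a
  power of z, as every factor does.
\<close>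
lemma coeff_rational_case:
  assumes S: "S \<subseteq> {0..N}" and w: "\<And>j. j \<le> N \<Longrightarrow> w j \<noteq> 0" and inj: "inj_on w {0..N}"
    and reg: "\<And>j. j \<le> N \<Longrightarrow> j \<notin> S \<Longrightarrow> - \<tau> j \<in> \<nat> - {0}"
    and poles: "\<And>j. j \<in> S \<Longrightarrow> \<tau> j = of_nat (L j)"
  shows "\<forall>\<^sub>F n in sequentially. G_coeff N \<tau> w n = (\<Sum>m\<in>S. \<Sum>r<L m. sing_coeff N \<tau> w m r n)"
proof -
  define h where "h = remove_sings (remainder N \<tau> w S L)"
  have int: "\<tau> j \<in> \<int>" if "j \<le> N" for j
  proof (cases "j \<in> S")
    case False
    hence "- \<tau> j \<in> \<int>" using reg[OF that] Nats_subset_Ints by blast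
    thus ?thesis by (simp only: minus_in_Ints_iff)
  qed (simp add: poles)
  have reg_an: "remainder N \<tau> w S L analytic_on {z0}" if "\<forall>j\<in>S. w j * z0 \<noteq> 1" for z0
    using that S reg int by (intro remainder_analytic_at) auto
  have "h analytic_on {z0}" for z0
  proof (cases "\<forall>j\<in>S. w j * z0 \<noteq> 1")
    case True
    thus ?thesis unfolding h_def by (intro remove_sings_analytic_on reg_an)
  next
    case False
    then obtain m where "m \<in> S" "w m * z0 = 1" by auto
    thus ?thesis unfolding h_def
      using remove_sings_remainder_analytic_at_pole[OF S _ w inj] int poles by blast
  qed
  hence hol: "h holomorphic_on UNIV"
    using analytic_on_analytic_at analytic_imp_holomorphic by blast
  define H where "H = Abs_fps (\<lambda>n. G_coeff N \<tau> w n - (\<Sum>m\<in>S. \<Sum>r<L m. sing_coeff N \<tau> w m r n))"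
  have "\<forall>\<^sub>F z in nhds 0. h z = remainder N \<tau> w S L z"
    unfolding h_def by (intro eventually_remove_sings_eq_nhds reg_an) auto
  hence H: "h has_fps_expansion H"
    using remainder_has_fps_expansion[of N \<tau> w S L] has_fps_expansion_cong[of h "remainder N \<tau> w S L" H H]
    by (simp add: H_def)
  have "poly_growth (remainder N \<tau> w S L)"
  proof -
    have "poly_growth (gen_fun N \<tau> w)"
      unfolding gen_fun_def[abs_def] using w int
      by (intro poly_growth_prod poly_growth_affine_powr) (auto simp: minus_in_Ints_iff)
    moreover have "poly_growth (\<lambda>z. (- 1) * (\<Sum>m\<in>S. \<Sum>r<L m. sing_term N \<tau> w m r z))"
      unfolding sing_term_def using w int S
      by (intro poly_growth_mult poly_growth_const poly_growth_sum poly_growth_affine_powr)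
         (auto simp: minus_in_Ints_iff intro!: Ints_diff)
    ultimately have "poly_growth (\<lambda>z. gen_fun N \<tau> w z + (- 1) * (\<Sum>m\<in>S. \<Sum>r<L m. sing_term N \<tau> w m r z))"
      by (rule poly_growth_add)
    thus ?thesis by (simp add: remainder_def[abs_def])
  qed
  then obtain d where d: "remainder N \<tau> w S L \<in> O[at_infinity](\<lambda>z. z ^ d)"
    by (auto simp: poly_growth_def)
  have "\<forall>\<^sub>F z in at_infinity. h z = remainder N \<tau> w S L z"
  proof -
    \<comment> \<open>Beyond this radius there are no singular points.\<close>
    define b where "b = 1 + (\<Sum>j\<in>S. norm (1 / w j))"
    have fin: "finite S" using S finite_subset by blast
    have "h z = remainder N \<tau> w S L z" if z: "b \<le> norm z" for z
    proof -
      have "w j * z \<noteq> 1" if j: "j \<in> S" for j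
      proof
        assume "w j * z = 1"
        moreover from this have "w j \<noteq> 0" by auto
        ultimately have "z = 1 / w j" by (simp add: field_simps)
        moreover have "norm (1 / w j) \<le> (\<Sum>j\<in>S. norm (1 / w j))"
          using fin j by (intro member_le_sum) auto
        ultimately show False using z by (simp add: b_def)
      qed
      thus ?thesis unfolding h_def by (intro remove_sings_at_analytic reg_an) auto
    qed
    thus ?thesis unfolding eventually_at_infinity by blast
  qed
  with d have "h \<in> O[at_infinity](\<lambda>z. z ^ d)"
    by (subst landau_o.big.in_cong)
  hence "fps_nth H n = 0" if "n > d" for n
    using coeff_eq_0_if_poly_growth[OF hol H] that by blast
  hence "G_coeff N \<tau> w n = (\<Sum>m\<in>S. \<Sum>r<L m. sing_coeff N \<tau> w m r n)" if "n > d" for n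
    using that by (simp add: H_def)
  thus ?thesis by (rule eventually_mono[OF eventually_gt_at_top[of d]])
qed

text \<open>
  Darboux's estimate. The set S contains every pole with |w_j| >= a and every index of non-integer
  type with |w_j| = a, and no index of non-integer type has |w_j| > a. The poles are removed
  exactly. At the others enough terms are removed for the remaining exponent to have real part at
  least p.
\<close>
lemma coeff_minus_sing_coeffs_bigo:
  assumes a: "0 < a"
    and S: "S \<subseteq> {0..N}" and w: "\<And>j. j \<le> N \<Longrightarrow> w j \<noteq> 0" and inj: "inj_on w {0..N}"
    and reg: "\<And>j. j \<le> N \<Longrightarrow> j \<notin> S \<Longrightarrow> - \<tau> j \<in> \<nat> - {0} \<or> norm (w j) < a"
    and sing: "\<And>j. j \<in> S \<Longrightarrow> \<tau> j = of_nat (L j) \<and> a \<le> norm (w j) \<or>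
                 norm (w j) = a \<and> real p \<le> Re (of_nat (L j) - \<tau> j)"
  shows "(\<lambda>n. norm (G_coeff N \<tau> w n - (\<Sum>m\<in>S. \<Sum>r<L m. sing_coeff N \<tau> w m r n)))
           \<in> O(\<lambda>n. a ^ n * real n powr (- real p))"
proof -
  define f where "f = remainder N \<tau> w S L"
  define h where "h = remove_sings f"
  define \<rho> where "\<rho> = 1 / a"
  have \<rho>: "0 < \<rho>" using a by (simp add: \<rho>_def)
  have fin: "finite S" using S finite_subset by blast
  have int_or: "\<tau> j \<in> \<int> \<or> norm (w j) \<le> a" if "j \<le> N" for j
  proof (cases "j \<in> S")
    case True
    thus ?thesis using sing[of j] by auto
  next
    case False
    hence "- \<tau> j \<in> \<int> \<or> norm (w j) < a" using reg[OF that] Nats_subset_Ints by blast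
    thus ?thesis by (auto simp only: minus_in_Ints_iff)
  qed
  have norm_le: "norm (w j * z0) \<le> norm (w j) / a" if "norm z0 \<le> \<rho>" for j z0
    using that a mult_left_mono[of "norm z0" \<rho> "norm (w j)"] by (simp add: \<rho>_def norm_mult)
  have f_an: "f analytic_on {z0}" if z0: "norm z0 \<le> \<rho>" "\<forall>j\<in>S. w j * z0 \<noteq> 1" for z0
    unfolding f_def
  proof (rule remainder_analytic_at[OF S])
    fix j assume j: "j \<le> N" "j \<notin> S"
    show "- \<tau> j \<in> \<nat> - {0} \<or> w j * z0 \<noteq> 1 \<and> (\<tau> j \<in> \<int> \<or> norm (w j * z0) \<le> 1)"
    proof (cases "- \<tau> j \<in> \<nat> - {0}")
      case False
      hence "norm (w j) < a" using reg[OF j] by blast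
      hence "norm (w j) / a < 1" using a by simp
      with norm_le[OF z0(1), of j] have lt: "norm (w j * z0) < 1" by linarith
      hence "w j * z0 \<noteq> 1" by (metis norm_one less_irrefl)
      with lt show ?thesis by simp
    qed blast
  next
    fix j assume j: "j \<in> S"
    hence "\<tau> j \<in> \<int> \<or> norm (w j) / a \<le> 1" using int_or[of j] S a by auto
    with z0(2) j norm_le[OF z0(1), of j]
    show "w j * z0 \<noteq> 1 \<and> (\<tau> j \<in> \<int> \<or> norm (w j * z0) \<le> 1)" by auto
  qed
  have h_reg: "h analytic_on {z0}" if "norm z0 \<le> \<rho>" "\<forall>j\<in>S. w j * z0 \<noteq> 1" for z0
    unfolding h_def by (intro remove_sings_analytic_on f_an that)
  have dom: "\<tau> j \<in> \<int> \<or> norm (w j) \<le> norm (w m)" if "m \<in> S" "j \<le> N" for m j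
    using sing[OF that(1)] int_or[OF that(2)] by auto
  have h_pole: "h analytic_on {z0}" if "m \<in> S" "\<tau> m = of_nat (L m)" "w m * z0 = 1" for m z0
    unfolding h_def f_def
    using that by (intro remove_sings_remainder_analytic_at_pole[OF S _ w inj dom]) auto
  \<comment> \<open>The only points of the closed disc at which analyticity can fail are branch points on the
    boundary circle.\<close>
  have cases: "h analytic_on {z0} \<or> (\<exists>m\<in>S. w m * z0 = 1 \<and> norm z0 = \<rho> \<and> real p \<le> Re (of_nat (L m) - \<tau> m))"
    if z0: "norm z0 \<le> \<rho>" for z0
  proof (cases "\<exists>m\<in>S. w m * z0 = 1")
    case True
    then obtain m where m: "m \<in> S" "w m * z0 = 1" by blast
    show ?thesis
    proof (cases "\<tau> m = of_nat (L m)")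
      case False
      hence *: "norm (w m) = a" "real p \<le> Re (of_nat (L m) - \<tau> m)" using sing[OF m(1)] by auto
      have "norm (w m) * norm z0 = 1" using m(2) by (metis norm_mult norm_one)
      hence "norm z0 = \<rho>" using * a by (simp add: \<rho>_def field_simps)
      thus ?thesis using * m by blast
    qed (use m h_pole in blast)
  qed (use z0 h_reg in blast)
  have hol: "h holomorphic_on ball 0 \<rho>"
  proof -
    have "h analytic_on {z0}" if "z0 \<in> ball 0 \<rho>" for z0
      using cases[of z0] that by auto
    thus ?thesis using analytic_on_analytic_at analytic_imp_holomorphic by blast
  qed
  define H where "H = Abs_fps (\<lambda>n. G_coeff N \<tau> w n - (\<Sum>m\<in>S. \<Sum>r<L m. sing_coeff N \<tau> w m r n))"
  have "\<forall>\<^sub>F z in nhds 0. h z = f z"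
    unfolding h_def using \<rho> by (intro eventually_remove_sings_eq_nhds f_an) auto
  hence H: "h has_fps_expansion H"
    using remainder_has_fps_expansion[of N \<tau> w S L] has_fps_expansion_cong[of h f H H]
    by (simp add: H_def f_def)
  have "\<exists>B. \<forall>\<^sub>F z in nhds z0. norm z < \<rho> \<longrightarrow> norm ((deriv ^^ p) h z) \<le> B" if z0: "z0 \<in> cball 0 \<rho>" for z0
  proof (cases "h analytic_on {z0}")
    case True
    from analytic_at_bounded_near[OF analytic_higher_deriv[OF this, of p]]
    show ?thesis by (auto elim: eventually_mono)
  next
    case False
    then obtain m where m: "m \<in> S" "w m * z0 = 1" "norm z0 = \<rho>" "real p \<le> Re (of_nat (L m) - \<tau> m)"
      using cases[of z0] z0 by auto
    have wm: "w m \<noteq> 0" using m(2) by auto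
    obtain g1 g2 where g: "g1 analytic_on {z0}" "g2 analytic_on {z0}" and
      ev: "\<forall>\<^sub>F z in nhds z0. f z = (1 - w m * z) powr (of_nat (L m) - \<tau> m) * g1 z + g2 z"
      unfolding f_def
      using remainder_near_singularity[OF S m(1) w inj dom[OF m(1)] m(2), of L] by blast
    have "\<forall>\<^sub>F z in nhds z0. w j * z \<noteq> 1" if j: "j \<in> S" "j \<noteq> m" for j
    proof -
      have "w j \<noteq> w m" using j m S inj by (auto simp: inj_on_def)
      hence "w j * z0 \<noteq> 1" using m(2) by (metis mult_cancel_right mult_zero_right zero_neq_one)
      moreover have "open {z. w j * z \<noteq> 1}" by (intro open_Collect_neq continuous_intros)
      ultimately show ?thesis
        using eventually_nhds_in_open[of "{z. w j * z \<noteq> 1}" z0] by simp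
    qed
    hence "\<forall>\<^sub>F z in nhds z0. \<forall>j\<in>S-{m}. w j * z \<noteq> 1"
      using fin by (intro eventually_ball_finite) auto
    with ev have "\<forall>\<^sub>F z in nhds z0. norm z < norm z0 \<longrightarrow>
        h z = (1 - w m * z) powr (of_nat (L m) - \<tau> m) * g1 z + g2 z"
    proof eventually_elim
      case (elim z)
      show ?case
      proof
        assume z: "norm z < norm z0"
        have "w m * z \<noteq> 1"
        proof
          assume "w m * z = 1"
          hence "w m * z = w m * z0" using m(2) by simp
          thus False using wm z by simp
        qed
        hence "\<forall>j\<in>S. w j * z \<noteq> 1" using elim(2) by auto
        hence "h z = f z" unfolding h_def
          using z m(3) by (intro remove_sings_at_analytic f_an) auto
        thus "h z = (1 - w m * z) powr (of_nat (L m) - \<tau> m) * g1 z + g2 z" using elim(1) by simp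
      qed
    qed
    from higher_deriv_bounded_near_branch_point[OF m(2,4) g this] show ?thesis
      using m(3) by simp
  qed
  then obtain B where "\<forall>z\<in>ball 0 \<rho>. norm ((deriv ^^ p) h z) \<le> B"
    using bounded_on_ball_if_locally_bounded[of \<rho> "(deriv ^^ p) h"] by blast
  from coeff_bigo_if_higher_deriv_bounded[OF hol \<rho> H, of p B] this
  show ?thesis by (simp add: H_def \<rho>_def)
qed

section \<open>Orders of magnitude of the singular coefficients\<close>

text \<open>
  This is Euler's limit formula for the reciprocal Gamma function, whose value at a is nonzero
  because a is not a pole of Gamma. The lower bound is what allows dividing the discrepancy by
  this quantity.
\<close>
lemma pochhammer_div_fact_bigtheta:
  fixes a :: complex
  assumes "a \<notin> \<int>\<^sub>\<le>\<^sub>0"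
  shows "(\<lambda>n. norm (pochhammer a n / fact n)) \<in> \<Theta>(\<lambda>n. real n powr (Re a - 1))"
proof (rule bigthetaI_tendsto)
  have "norm (rGamma a) \<noteq> 0" using assms by (simp add: rGamma_eq_zero_iff)
  thus "norm (rGamma a) \<noteq> 0" .
  have "(\<lambda>n. norm (rGamma_series a n) * inverse (norm (a / of_nat n + 1))) \<longlonglongrightarrow> norm (rGamma a) * inverse (norm (0 + 1 :: complex))"
    by (intro tendsto_intros rGamma_series_LIMSEQ lim_const_over_n) auto
  moreover have "\<forall>\<^sub>F n in sequentially. norm (rGamma_series a n) * inverse (norm (a / of_nat n + 1)) =
      norm (pochhammer a n / fact n) / real n powr (Re a - 1)"
    using eventually_gt_at_top[of 0]
  proof eventually_elim
    case (elim n)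
    have an: "a + of_nat n \<noteq> 0"
    proof
      assume "a + of_nat n = 0"
      hence "a = - of_nat n" by (simp add: eq_neg_iff_add_eq_0)
      with assms show False by simp
    qed
    have "a / of_nat n + 1 = (a + of_nat n) / of_nat n" using elim by (simp add: field_simps)
    moreover have "norm (exp (a * of_real (ln (of_nat n)))) = real n powr Re a"
      using elim by (simp add: powr_def)
    moreover have "real n powr Re a = real n powr (Re a - 1) * real n"
      using elim powr_add[of "real n" "Re a - 1" 1] by simp
    ultimately show ?case
      using an elim
      by (simp add: rGamma_series_def pochhammer_Suc norm_mult norm_divide divide_simps)
  qed
  ultimately show "(\<lambda>n. norm (pochhammer a n / fact n) / real n powr (Re a - 1)) \<longlonglongrightarrow> norm (rGamma a)"
    using tendsto_cong by force
qed

lemma bigo_of_real_iff: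
  fixes f :: "nat \<Rightarrow> complex"
  shows "f \<in> O(\<lambda>n. complex_of_real (E n)) \<longleftrightarrow> (\<lambda>n. norm (f n)) \<in> O(E)"
  by (simp add: bigo_def)

lemma geometric_powr_bigo:
  fixes a b x y :: real
  assumes "0 \<le> b" "b < a \<or> b = a \<and> x \<le> y"
  shows "(\<lambda>n. b ^ n * real n powr x) \<in> O(\<lambda>n. a ^ n * real n powr y)"
proof (cases "b = a")
  case True
  hence "x \<le> y" using assms by auto
  show ?thesis
  proof (rule bigoI[of _ 1])
    show "\<forall>\<^sub>F n in sequentially. norm (b ^ n * real n powr x) \<le> 1 * norm (a ^ n * real n powr y)"
      using eventually_ge_at_top[of 1]
      by eventually_elim (use True assms \<open>x \<le> y\<close> in \<open>auto simp: abs_mult intro!: mult_left_mono powr_mono\<close>)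
  qed
next
  case False
  hence ab: "b < a" "0 < a" using assms by auto
  \<comment> \<open>A ratio q < 1 between b / a and 1; taking b / a itself would fail for b = 0.\<close>
  define q where "q = (b + a) / (2 * a)"
  have q: "0 < q" "q < 1" "b \<le> a * q" using ab assms by (auto simp: q_def field_simps)
  have "(\<lambda>n. q ^ n * real n powr (x - y)) \<longlonglongrightarrow> 0"
  proof -
    define l where "l = ln q"
    have l: "l < 0" using q by (simp add: l_def)
    have "(\<lambda>n. exp (l * real n) * real n powr (x - y)) \<longlonglongrightarrow> 0"
      using l by real_asymp
    moreover have "exp (l * real n) = q ^ n" for n
      using q by (simp add: l_def mult.commute[of "ln q"] exp_of_nat_mult)
    ultimately show ?thesis by simp
  qed
  hence "\<forall>\<^sub>F n in sequentially. q ^ n * real n powr (x - y) < 1"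
    by (rule order_tendstoD) simp
  hence "\<forall>\<^sub>F n in sequentially. norm (b ^ n * real n powr x) \<le> 1 * norm (a ^ n * real n powr y)"
    using eventually_ge_at_top[of 1]
  proof eventually_elim
    case (elim n)
    have "b ^ n * real n powr x \<le> (a * q) ^ n * real n powr x"
      using q assms by (intro mult_right_mono power_mono) auto
    also have "(a * q) ^ n * real n powr x = (q ^ n * real n powr (x - y)) * (a ^ n * real n powr y)"
      using powr_add[of "real n" "x - y" y] by (simp add: power_mult_distrib)
    also have "\<dots> \<le> 1 * (a ^ n * real n powr y)"
      using elim ab by (intro mult_right_mono) auto
    finally show ?case using ab assms by (simp add: abs_mult)
  qed
  thus ?thesis by (rule bigoI)
qed

lemma sing_coeff_bigo:
  assumes "\<tau> m - of_nat r \<notin> \<int>\<^sub>\<le>\<^sub>0"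
    and "norm (w m) < a \<or> norm (w m) = a \<and> Re (\<tau> m) - real r - 1 \<le> y"
  shows "sing_coeff N \<tau> w m r \<in> O(\<lambda>n. complex_of_real (a ^ n * real n powr y))"
proof -
  have "(\<lambda>n. norm (pochhammer (\<tau> m - of_nat r) n / fact n)) \<in> O(\<lambda>n. real n powr (Re (\<tau> m - of_nat r) - 1))"
    using pochhammer_div_fact_bigtheta[OF assms(1)] by (rule bigthetaD1)
  hence "(\<lambda>n. norm (pochhammer (\<tau> m - of_nat r) n / fact n) * norm (w m) ^ n) \<in>
      O(\<lambda>n. real n powr (Re (\<tau> m) - real r - 1) * norm (w m) ^ n)"
    by (intro landau_o.big.mult) auto
  also have "(\<lambda>n. real n powr (Re (\<tau> m) - real r - 1) * norm (w m) ^ n) \<in> O(\<lambda>n. a ^ n * real n powr y)"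
    using geometric_powr_bigo[of "norm (w m)" a "Re (\<tau> m) - real r - 1" y] assms(2)
    by (simp add: mult.commute)
  finally have "(\<lambda>n. norm (A_const N \<tau> w m * c_coeff N \<tau> w m r) *
      (norm (pochhammer (\<tau> m - of_nat r) n / fact n) * norm (w m) ^ n)) \<in> O(\<lambda>n. a ^ n * real n powr y)"
    by (cases "norm (A_const N \<tau> w m * c_coeff N \<tau> w m r) = 0") simp_all
  thus ?thesis
    unfolding bigo_of_real_iff sing_coeff_def by (simp add: norm_mult norm_power norm_divide mult.assoc)
qed

lemma pochhammer_of_nat_Suc_div_fact:
  "pochhammer (of_nat (Suc r)) n / fact n = (fact (n + r) / (fact r * fact n) :: complex)"
proof -
  have "(fact (n + r) :: complex) = fact r * pochhammer (of_nat (Suc r)) n"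
    using pochhammer_product'[of "1 :: complex" r n] by (simp add: pochhammer_fact add.commute)
  thus ?thesis by (simp add: field_simps)
qed

text \<open>
  The contribution of a pole is the same sum of singular coefficients, read backwards: the index r
  stands for the pole order r + 1, and (r + 1)_n / n! = (n + r)! / (r! n!).
\<close>
lemma sum_sing_coeff_pole:
  assumes "\<tau> m = of_nat (k m)" "k m \<ge> 1"
  shows "(\<Sum>r\<in>{0..k m - 1}.
           A_const N \<tau> w m * w m ^ n * (fact (n + r) * c_coeff N \<tau> w m (k m - r - 1) / (fact r * fact n))) =
         (\<Sum>r<k m. sing_coeff N \<tau> w m r n)"
proof -
  have "{0..k m - 1} = {..<k m}" using assms(2) by auto
  hence "(\<Sum>r\<in>{0..k m - 1}.
           A_const N \<tau> w m * w m ^ n * (fact (n + r) * c_coeff N \<tau> w m (k m - r - 1) / (fact r * fact n))) =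
      (\<Sum>r<k m. A_const N \<tau> w m * w m ^ n * (fact (n + r) * c_coeff N \<tau> w m (k m - r - 1) / (fact r * fact n)))"
    by simp
  also have "\<dots> = (\<Sum>r<k m. sing_coeff N \<tau> w m (k m - Suc r) n)"
  proof (intro sum.cong refl)
    fix r assume "r \<in> {..<k m}"
    hence "\<tau> m - of_nat (k m - Suc r) = of_nat (Suc r)"
      using assms(1) by (simp add: of_nat_diff)
    thus "A_const N \<tau> w m * w m ^ n * (fact (n + r) * c_coeff N \<tau> w m (k m - r - 1) / (fact r * fact n)) =
        sing_coeff N \<tau> w m (k m - Suc r) n"
      unfolding sing_coeff_def by (simp only: pochhammer_of_nat_Suc_div_fact) simp
  qed
  also have "\<dots> = (\<Sum>r<k m. sing_coeff N \<tau> w m r n)" by (rule sum.nat_diff_reindex)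
  finally show ?thesis .
qed

section \<open>The asymptotic expansion\<close>

lemma finite_lex_max:
  fixes f g :: "'a \<Rightarrow> real"
  assumes "finite M" "M \<noteq> {}"
  obtains m where "m \<in> M" "\<And>j. j \<in> M \<Longrightarrow> f j < f m \<or> f j = f m \<and> g j \<le> g m"
proof -
  define M' where "M' = {j\<in>M. f j = Max (f ` M)}"
  have "Max (f ` M) \<in> f ` M" using assms by (intro Max_in) auto
  then obtain i where "i \<in> M" "f i = Max (f ` M)" by force
  hence M': "finite M'" "M' \<noteq> {}" using assms by (auto simp: M'_def)
  have "Max (g ` M') \<in> g ` M'" using M' by (intro Max_in) auto
  then obtain m where m: "m \<in> M'" "g m = Max (g ` M')" by force
  show ?thesis
  proof (rule that)
    show "m \<in> M" using m by (simp add: M'_def)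
    fix j assume j: "j \<in> M"
    have "f j \<le> f m" using j m assms by (simp add: M'_def)
    moreover have "g j \<le> g m" if "f j = f m"
      using that j m M' by (simp add: M'_def)
    ultimately show "f j < f m \<or> f j = f m \<and> g j \<le> g m" by fastforce
  qed
qed

text \<open>
  At every index of non-integer type, the terms with r >= 1 are already of the order of the error.
  So the expansion with the given K m can be exchanged for the one with L m terms that Darboux's
  estimate needs.
\<close>
lemma coeff_asymptotics_bigo:
  assumes w: "\<And>j. j \<le> N \<Longrightarrow> w j \<noteq> 0" and inj: "inj_on w {0..N}"
    and MP: "M \<subseteq> {0..N}" "P \<subseteq> {0..N}" "M \<inter> P = {}"
    and M: "\<And>j. j \<in> M \<Longrightarrow> \<tau> j \<notin> \<int>"
    and P: "\<And>j. j \<in> P \<Longrightarrow> \<tau> j = of_nat (k j)"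
    and rest: "\<And>j. j \<le> N \<Longrightarrow> j \<notin> M \<Longrightarrow> j \<notin> P \<Longrightarrow> - \<tau> j \<in> \<nat> - {0}"
    and m0: "m0 \<in> M"
    and max: "\<And>j. j \<in> M \<Longrightarrow> norm (w j) < norm (w m0) \<or> norm (w j) = norm (w m0) \<and> Re (\<tau> j) \<le> Re (\<tau> m0)"
  shows "(\<lambda>n. G_coeff N \<tau> w n - (\<Sum>m\<in>M. \<Sum>r\<le>K m. sing_coeff N \<tau> w m r n)
              - (\<Sum>m\<in>P. \<Sum>r<k m. sing_coeff N \<tau> w m r n))
         \<in> O(\<lambda>n. complex_of_real (norm (w m0) ^ n * real n powr (Re (\<tau> m0) - 2)))"
proof -
  define a where "a = norm (w m0)"
  define E where "E = (\<lambda>n. complex_of_real (a ^ n * real n powr (Re (\<tau> m0) - 2)))"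
  define T where "T = sing_coeff N \<tau> w"
  \<comment> \<open>The gain n^(-p) must reach n^(Re tau_m0 - 2), and L m is large enough that
    Re (L m - tau_m) >= p; the successor ensures that the term r = 0 is included.\<close>
  define p where "p = nat \<lceil>2 - Re (\<tau> m0)\<rceil>"
  define M1 where "M1 = {m\<in>M. norm (w m) = a}"
  define P1 where "P1 = {m\<in>P. a \<le> norm (w m)}"
  define L where "L = (\<lambda>m. if m \<in> P then k m else Suc (nat \<lceil>real p + Re (\<tau> m)\<rceil>))"
  have fin: "finite M" "finite P" using MP finite_subset by blast+
  have a: "0 < a" using w m0 MP by (auto simp: a_def)
  have nonint: "\<tau> m - of_nat r \<notin> \<int>\<^sub>\<le>\<^sub>0" if "m \<in> M" for m r
  proof
    assume "\<tau> m - of_nat r \<in> \<int>\<^sub>\<le>\<^sub>0"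
    hence "\<tau> m - of_nat r + of_nat r \<in> \<int>" by (intro Ints_add) auto
    thus False using M[OF that] by simp
  qed
  have main: "(\<lambda>n. G_coeff N \<tau> w n - (\<Sum>m\<in>M1\<union>P1. \<Sum>r<L m. T m r n)) \<in> O(E)"
  proof -
    have "(\<lambda>n. norm (G_coeff N \<tau> w n - (\<Sum>m\<in>M1\<union>P1. \<Sum>r<L m. sing_coeff N \<tau> w m r n)))
           \<in> O(\<lambda>n. a ^ n * real n powr (- real p))"
    proof (rule coeff_minus_sing_coeffs_bigo[OF a _ w inj])
      show "M1 \<union> P1 \<subseteq> {0..N}" using MP by (auto simp: M1_def P1_def)
    next
      fix j assume j: "j \<le> N" "j \<notin> M1 \<union> P1"
      show "- \<tau> j \<in> \<nat> - {0} \<or> norm (w j) < a"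
        using j rest[of j] max[of j] by (fastforce simp: M1_def P1_def a_def)
    next
      fix j assume j: "j \<in> M1 \<union> P1"
      show "\<tau> j = of_nat (L j) \<and> a \<le> norm (w j) \<or> norm (w j) = a \<and> real p \<le> Re (of_nat (L j) - \<tau> j)"
      proof (cases "j \<in> P")
        case True
        thus ?thesis using j MP P[OF True] by (auto simp: M1_def P1_def L_def)
      next
        case False
        hence "norm (w j) = a" using j by (auto simp: M1_def P1_def)
        moreover have "real p + Re (\<tau> j) \<le> real (L j)"
          using False by (simp add: L_def) linarith
        ultimately show ?thesis by simp
      qed
    qed auto
    also have "(\<lambda>n. a ^ n * real n powr (- real p)) \<in> O(\<lambda>n. a ^ n * real n powr (Re (\<tau> m0) - 2))"
      using a by (intro geometric_powr_bigo) (auto simp: p_def, linarith)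
    finally show ?thesis unfolding E_def T_def bigo_of_real_iff .
  qed
  have small: "T m r \<in> O(E)" if "m \<in> M" "m \<notin> M1 \<or> r \<ge> 1" for m r
    unfolding T_def E_def using that max[of m] nonint[of m r]
    by (intro sing_coeff_bigo) (auto simp: M1_def a_def)
  have smallP: "T m r \<in> O(E)" if "m \<in> P - P1" "r < k m" for m r
    unfolding T_def E_def
  proof (rule sing_coeff_bigo)
    have "\<tau> m - of_nat r = of_nat (k m - r)" using that P[of m] by (simp add: of_nat_diff)
    moreover have "k m - r \<noteq> 0" using that by simp
    ultimately show "\<tau> m - of_nat r \<notin> \<int>\<^sub>\<le>\<^sub>0" by (metis of_nat_in_nonpos_Ints_iff)
  qed (use that in \<open>auto simp: P1_def\<close>)
  have M1: "(\<lambda>n. (\<Sum>r<L m. T m r n) - (\<Sum>r\<le>K m. T m r n)) \<in> O(E)" if m: "m \<in> M1" for m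
  proof -
    have "m \<in> M" "m \<notin> P" using m MP by (auto simp: M1_def)
    then obtain l where l: "L m = Suc l" by (simp add: L_def)
    have "(\<Sum>r<L m. T m r n) - (\<Sum>r\<le>K m. T m r n) =
        (\<Sum>r<l. T m (Suc r) n) - (\<Sum>r<K m. T m (Suc r) n)" for n
      unfolding l lessThan_Suc_atMost[symmetric] sum.lessThan_Suc_shift by simp
    moreover have "(\<lambda>n. (\<Sum>r<l. T m (Suc r) n) - (\<Sum>r<K m. T m (Suc r) n)) \<in> O(E)"
      using small[OF \<open>m \<in> M\<close>] by (intro sum_in_bigo big_sum_in_bigo) auto
    ultimately show ?thesis by simp
  qed
  have "(\<lambda>n. \<Sum>m\<in>M1. (\<Sum>r<L m. T m r n) - (\<Sum>r\<le>K m. T m r n)) \<in> O(E)"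
    by (intro big_sum_in_bigo M1)
  note error = sum_in_bigo(1)[OF main this]
  have "(\<lambda>n. \<Sum>m\<in>M-M1. \<Sum>r\<le>K m. T m r n) \<in> O(E)"
    by (intro big_sum_in_bigo small) auto
  note error = sum_in_bigo(2)[OF error this]
  have "(\<lambda>n. \<Sum>m\<in>P-P1. \<Sum>r<k m. T m r n) \<in> O(E)"
    by (intro big_sum_in_bigo smallP) auto
  note error = sum_in_bigo(2)[OF error this]
  have "(G_coeff N \<tau> w n - (\<Sum>m\<in>M1\<union>P1. \<Sum>r<L m. T m r n))
      + (\<Sum>m\<in>M1. (\<Sum>r<L m. T m r n) - (\<Sum>r\<le>K m. T m r n))
      - (\<Sum>m\<in>M-M1. \<Sum>r\<le>K m. T m r n) - (\<Sum>m\<in>P-P1. \<Sum>r<k m. T m r n) =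
      G_coeff N \<tau> w n - (\<Sum>m\<in>M. \<Sum>r\<le>K m. T m r n) - (\<Sum>m\<in>P. \<Sum>r<k m. T m r n)" for n
  proof -
    have "(\<Sum>m\<in>M1\<union>P1. \<Sum>r<L m. T m r n) = (\<Sum>m\<in>M1. \<Sum>r<L m. T m r n) + (\<Sum>m\<in>P1. \<Sum>r<L m. T m r n)"
      using fin MP by (intro sum.union_disjoint) (auto simp: M1_def P1_def)
    moreover have "(\<Sum>m\<in>P1. \<Sum>r<L m. T m r n) = (\<Sum>m\<in>P1. \<Sum>r<k m. T m r n)"
      by (intro sum.cong) (auto simp: P1_def L_def)
    moreover have "(\<Sum>m\<in>M. \<Sum>r\<le>K m. T m r n) = (\<Sum>m\<in>M-M1. \<Sum>r\<le>K m. T m r n) + (\<Sum>m\<in>M1. \<Sum>r\<le>K m. T m r n)"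
      using fin by (intro sum.subset_diff) (auto simp: M1_def)
    moreover have "(\<Sum>m\<in>P. \<Sum>r<k m. T m r n) = (\<Sum>m\<in>P-P1. \<Sum>r<k m. T m r n) + (\<Sum>m\<in>P1. \<Sum>r<k m. T m r n)"
      using fin by (intro sum.subset_diff) (auto simp: P1_def)
    ultimately show ?thesis by (simp add: sum_subtractf algebra_simps)
  qed
  with error show ?thesis by (simp only: E_def T_def a_def)
qed

text \<open>
  The order n^(Re tau - 2) of the discrepancy against the order n^(Re tau - 1) of the
  coefficient that multiplies the error leaves the required factor 1 / n.
\<close>
lemma absorb_error:
  fixes b \<tau> v :: complex and R :: "nat \<Rightarrow> complex"
  assumes b: "b \<noteq> 0" and \<tau>: "\<tau> \<notin> \<int>\<^sub>\<le>\<^sub>0"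
    and R: "R \<in> O(\<lambda>n. complex_of_real (norm v ^ n * real n powr (Re \<tau> - 2)))"
  shows "(\<lambda>n. R n / (b * (pochhammer \<tau> n / fact n))) \<in> O(\<lambda>n. v ^ n / of_nat n)"
proof -
  have "(\<lambda>n. norm (R n)) \<in> O(\<lambda>n. norm v ^ n * real n powr (Re \<tau> - 2))"
    using R by (simp only: bigo_of_real_iff)
  moreover have "(\<lambda>n. inverse (norm (pochhammer \<tau> n / fact n))) \<in> O(\<lambda>n. inverse (real n powr (Re \<tau> - 1)))"
  proof -
    have "pochhammer \<tau> n \<noteq> 0" for n using \<tau> by (auto simp: pochhammer_eq_0_iff)
    moreover have "\<forall>\<^sub>F n in sequentially. real n powr (Re \<tau> - 1) \<noteq> 0"
      using eventually_gt_at_top[of 0] by eventually_elim simp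
    ultimately show ?thesis
      using bigthetaD2[OF pochhammer_div_fact_bigtheta[OF \<tau>]]
      by (intro landau_o.big.inverse) (auto simp: bigomega_iff_bigo)
  qed
  ultimately have "(\<lambda>n. norm (R n) * inverse (norm (pochhammer \<tau> n / fact n)) * inverse (norm b)) \<in>
      O(\<lambda>n. norm v ^ n * real n powr (Re \<tau> - 2) * inverse (real n powr (Re \<tau> - 1)))"
    using b by (subst landau_o.big.cmult_in_iff') (auto intro: landau_o.big.mult)
  also have "(\<lambda>n. norm v ^ n * real n powr (Re \<tau> - 2) * inverse (real n powr (Re \<tau> - 1))) \<in>
      \<Theta>(\<lambda>n. norm (v ^ n / of_nat n))"
  proof (rule bigthetaI_cong)
    show "\<forall>\<^sub>F n in sequentially. norm v ^ n * real n powr (Re \<tau> - 2) * inverse (real n powr (Re \<tau> - 1)) =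
        norm (v ^ n / of_nat n)"
      using eventually_gt_at_top[of 0]
    proof eventually_elim
      case (elim n)
      have "real n powr (Re \<tau> - 1) = real n powr (Re \<tau> - 2) * real n"
        using elim powr_add[of "real n" "Re \<tau> - 2" 1] by simp
      thus ?case using elim by (simp add: norm_divide norm_power field_simps)
    qed
  qed
  finally have "(\<lambda>n. norm (R n / (b * (pochhammer \<tau> n / fact n)))) \<in> O(\<lambda>n. norm (v ^ n / of_nat n))"
    by (simp add: norm_divide norm_mult field_simps)
  thus ?thesis by simp
qed

theorem theorem1:
  fixes N :: nat and N1 N2 :: int
    and w \<tau> :: "nat \<Rightarrow> complex" and k K :: "nat \<Rightarrow> nat"
  assumes "N \<ge> 1"
    and "\<And>j. j \<le> N \<Longrightarrow> w j \<noteq> 0"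
    and "inj_on w {0..N}"
    and "-1 \<le> N1" and "N1 \<le> N2" and "N2 \<le> int N"
    and "\<And>j. int j \<le> N1 \<Longrightarrow> \<tau> j \<notin> \<nat> \<and> - \<tau> j \<notin> \<nat>"
    and "\<And>j. N1 + 1 \<le> int j \<Longrightarrow> int j \<le> N2 \<Longrightarrow> \<tau> j = of_nat (k j) \<and> k j \<ge> 1"
    and "\<And>j. N2 + 1 \<le> int j \<Longrightarrow> j \<le> N \<Longrightarrow> - \<tau> j \<in> \<nat> - {0}"
  shows "\<exists>e :: nat \<Rightarrow> nat \<Rightarrow> nat \<Rightarrow> complex.
    (\<forall>m r. int m \<le> N1 \<longrightarrow> r \<le> K m \<longrightarrow> e m r \<in> O(\<lambda>n. w m ^ n / of_nat n)) \<and>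
    (\<forall>\<^sub>F n in sequentially.
      G_coeff N \<tau> w n =
        (\<Sum>m | int m \<le> N1. \<Sum>r\<in>{0..K m}.
           A_const N \<tau> w m * c_coeff N \<tau> w m r * (pochhammer (\<tau> m - of_nat r) n / fact n) * (w m ^ n + e m r n)) +
        (\<Sum>m | N1 + 1 \<le> int m \<and> int m \<le> N2. \<Sum>r\<in>{0..k m - 1}.
           A_const N \<tau> w m * w m ^ n * (fact (n + r) * c_coeff N \<tau> w m (k m - r - 1) / (fact r * fact n))))"
proof -
  define M where "M = {m. int m \<le> N1}"
  define P where "P = {m. N1 + 1 \<le> int m \<and> int m \<le> N2}"
  define T where "T = sing_coeff N \<tau> w"
  note w = assms(2) and inj = assms(3)
  have MP: "M \<subseteq> {0..N}" "P \<subseteq> {0..N}" "M \<inter> P = {}" using assms(5,6) by (auto simp: M_def P_def)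
  have fin: "finite M" using MP finite_subset by blast
  have M: "\<tau> j \<notin> \<int>" if "j \<in> M" for j
  proof
    assume "\<tau> j \<in> \<int>"
    then obtain i where i: "\<tau> j = of_int i" by (auto elim: Ints_cases)
    show False
    proof (cases "i \<ge> 0")
      case True
      hence "\<tau> j = of_nat (nat i)" using i by simp
      thus False using assms(7)[of j] that by (auto simp: M_def)
    next
      case False
      hence "- \<tau> j = of_nat (nat (- i))" using i by simp
      thus False using assms(7)[of j] that by (metis M_def mem_Collect_eq of_nat_in_Nats)
    qed
  qed
  have P: "\<tau> j = of_nat (k j)" "k j \<ge> 1" if "j \<in> P" for j
    using assms(8)[of j] that by (auto simp: P_def)
  have rest: "- \<tau> j \<in> \<nat> - {0}" if "j \<le> N" "j \<notin> M" "j \<notin> P" for j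
    using assms(9)[of j] that by (auto simp: M_def P_def)
  have poles: "(\<Sum>m\<in>P. \<Sum>r\<in>{0..k m - 1}.
           A_const N \<tau> w m * w m ^ n * (fact (n + r) * c_coeff N \<tau> w m (k m - r - 1) / (fact r * fact n))) =
      (\<Sum>m\<in>P. \<Sum>r<k m. T m r n)" for n
    unfolding T_def using P by (intro sum.cong refl sum_sing_coeff_pole) auto
  show ?thesis
  proof (cases "M = {}")
    case True
    have "\<forall>\<^sub>F n in sequentially. G_coeff N \<tau> w n = (\<Sum>m\<in>P. \<Sum>r<k m. T m r n)"
      unfolding T_def using True by (intro coeff_rational_case MP w inj rest P) auto
    thus ?thesis
      unfolding M_def[symmetric] P_def[symmetric] poles True
      by (intro exI[of _ "\<lambda>_ _ _. 0"]) (use True in \<open>auto simp: M_def\<close>)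
  next
    case False
    obtain m0 where m0: "m0 \<in> M" and max: "\<And>j. j \<in> M \<Longrightarrow>
        norm (w j) < norm (w m0) \<or> norm (w j) = norm (w m0) \<and> Re (\<tau> j) \<le> Re (\<tau> m0)"
      by (rule finite_lex_max[OF fin False, of "\<lambda>j. norm (w j)" "\<lambda>j. Re (\<tau> j)"]) (rule that)
    define R where "R = (\<lambda>n. G_coeff N \<tau> w n - (\<Sum>m\<in>M. \<Sum>r\<le>K m. T m r n) - (\<Sum>m\<in>P. \<Sum>r<k m. T m r n))"
    define q where "q = (\<lambda>m r n. A_const N \<tau> w m * c_coeff N \<tau> w m r * (pochhammer (\<tau> m - of_nat r) n / fact n))"
    define e :: "nat \<Rightarrow> nat \<Rightarrow> nat \<Rightarrow> complex" where "e = (\<lambda>m r n. if m = m0 \<and> r = 0 then R n / q m0 0 n else 0)"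
    have R: "R \<in> O(\<lambda>n. complex_of_real (norm (w m0) ^ n * real n powr (Re (\<tau> m0) - 2)))"
      unfolding R_def T_def by (intro coeff_asymptotics_bigo[OF w inj MP M P(1) rest m0 max]) auto
    have nonint: "\<tau> m0 \<notin> \<int>\<^sub>\<le>\<^sub>0" using M[OF m0] nonpos_Ints_subset_Ints by blast
    have A: "A_const N \<tau> w m0 \<noteq> 0" using m0 MP w inj by (intro A_const_nonzero) auto
    have q: "q m0 0 n = A_const N \<tau> w m0 * (pochhammer (\<tau> m0) n / fact n)" for n
      by (simp add: q_def c_coeff_0)
    have q_nz: "q m0 0 n \<noteq> 0" for n
      unfolding q using A nonint by (auto simp: pochhammer_eq_0_iff)
    have "e m r \<in> O(\<lambda>n. w m ^ n / of_nat n)" for m r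
    proof (cases "m = m0 \<and> r = 0")
      case True
      hence "e m r = (\<lambda>n. R n / (A_const N \<tau> w m0 * (pochhammer (\<tau> m0) n / fact n)))"
        by (simp add: e_def q)
      thus ?thesis using absorb_error[OF A nonint R] True by simp
    next
      case False
      hence "e m r = (\<lambda>_. 0)" by (auto simp: e_def)
      thus ?thesis by simp
    qed
    moreover have "G_coeff N \<tau> w n = (\<Sum>m\<in>M. \<Sum>r\<in>{0..K m}. q m r n * (w m ^ n + e m r n)) +
        (\<Sum>m\<in>P. \<Sum>r<k m. T m r n)" for n
    proof -
      have "(\<Sum>m\<in>M. \<Sum>r\<in>{0..K m}. q m r n * e m r n) = (\<Sum>m\<in>M. if m = m0 then R n else 0)"
      proof (intro sum.cong refl)
        fix m
        have "(\<Sum>r\<in>{0..K m}. q m r n * e m r n) = (\<Sum>r\<in>{0..K m}. if r = 0 then (if m = m0 then R n else 0) else 0)"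
          using q_nz by (intro sum.cong) (auto simp: e_def)
        thus "(\<Sum>r\<in>{0..K m}. q m r n * e m r n) = (if m = m0 then R n else 0)" by simp
      qed
      also have "\<dots> = R n" using fin m0 by simp
      finally have "(\<Sum>m\<in>M. \<Sum>r\<in>{0..K m}. q m r n * e m r n) = R n" .
      moreover have "(\<Sum>m\<in>M. \<Sum>r\<in>{0..K m}. q m r n * w m ^ n) = (\<Sum>m\<in>M. \<Sum>r\<le>K m. T m r n)"
        by (simp add: q_def T_def sing_coeff_def atLeast0AtMost)
      ultimately have "(\<Sum>m\<in>M. \<Sum>r\<in>{0..K m}. q m r n * (w m ^ n + e m r n)) =
          (\<Sum>m\<in>M. \<Sum>r\<le>K m. T m r n) + R n"
        by (simp add: ring_distribs sum.distrib)
      thus ?thesis by (simp add: R_def)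
    qed
    ultimately show ?thesis
      unfolding M_def[symmetric] P_def[symmetric] poles
      by (intro exI[of _ e]) (auto simp: q_def)
  qed
qed

end
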